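(* For every integer $N\ge1$, with the $2N\times 2N$ rational matrices $\Omega_{2N}$, $\mathsf J_{2N}$ and $C^{(N)}$ defined in the context, $$\Omega_{2N}\bigl(\mathsf J_{2N}-C^{(N)}\bigr)=I_{2N},\qquad \Omega_{2N}^{-1}=\mathsf J_{2N}-C^{(N)}.$$
   Context: All matrices are indexed from zero. For $q\ge1$ let $R_q$ be the $q\times q$ reversal matrix, $(R_q)_{ij}=1$ if $i+j=q-1$ and $0$ otherwise, and let $(\mathsf G_q)_{ij}=(-1)^{i+j}\binom{i+j}{i}$ for $0\le i,j<q$ (this matrix has determinant $1$, so it is invertible). Define $$\Omega_q=\mathsf G_qR_q-R_q\mathsf G_q,\qquad \mathsf J_q=R_q\mathsf G_q^{-1}-\mathsf G_q^{-1}R_q .$$ For $m\ge1$ let $$h_m(z)=\sum_{a=0}^{m-1}\frac{\binom{m+a-1}{m-1}\binom{2m-a-2}{m-1}}{\binom{3m-2}{m-1}}z^a,\qquad b_m=h_m(0).$$ For $N\ge1$ put $b=b_{N+1}$ and define the polynomials $$u(x)=x\,h_{N+1}(1+x),\quad v(x)=(1+x)h_N(1+x),\quad u^*(x)=x^{N+1}u(1/x),\quad v^*(x)=x^{N+1}v(1/x),$$ $$W(x,y)=u(x)v(y)-u(y)v(x),\qquad W^*(x,y)=u^*(x)v^*(y)-u^*(y)v^*(x),$$ and the rational functions $$\mathscr H_N(x,y)=\frac{W(x,y)W^*(x,y)}{b^2(y-x)(1+x+xy)(1+y+xy)},\qquad \mathscr C_N(x,y)=\mathscr H_N(x,y)-\frac{x^{2N}}{1+y+xy}+\frac{y^{2N}}{1+x+xy}.$$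 It is a fact that $\mathscr C_N$ is a polynomial of degree at most $2N-1$ in each of $x,y$. Write $\mathscr C_N=\sum_{0\le i,j<2N}c_{ij}x^iy^j$ and let $C^{(N)}=(c_{ij})_{0\le i,j<2N}$ be its coefficient matrix. *)

theory Defs
  imports
    "Jordan_Normal_Form.Gauss_Jordan_Elimination"
    "HOL-Computational_Algebra.Polynomial_Factorial"
begin

definition reversal_mat :: "nat \<Rightarrow> rat mat" where
  "reversal_mat q = mat q q (\<lambda>(i, j). if i + j = q - 1 then 1 else 0)"

definition G_mat :: "nat \<Rightarrow> rat mat" where
  "G_mat q = mat q q (\<lambda>(i, j). (- 1) ^ (i + j) * of_nat ((i + j) choose i))"

definition G_inv :: "nat \<Rightarrow> rat mat" where
  "G_inv q = the (mat_inverse (G_mat q))"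

definition Omega_mat :: "nat \<Rightarrow> rat mat" where
  "Omega_mat q = G_mat q * reversal_mat q - reversal_mat q * G_mat q"

definition J_mat :: "nat \<Rightarrow> rat mat" where
  "J_mat q = reversal_mat q * G_inv q - G_inv q * reversal_mat q"

text \<open>
  The polynomials and rational functions are given as expressions over an arbitrary field of
  characteristic zero. They are used at the two indeterminates of \<open>\<rat>(x, y)\<close>, where none of the
  denominators vanishes, so that they denote formal rational functions there.
\<close>

definition h_fun :: "nat \<Rightarrow> 'a::field_char_0 \<Rightarrow> 'a" where
  "h_fun m z = (\<Sum>a = 0..m - 1.
     of_nat ((m + a - 1) choose (m - 1)) * of_nat ((2 * m - a - 2) choose (m - 1))
       / of_nat ((3 * m - 2) choose (m - 1)) * z ^ a)"

definition b_coeff :: "nat \<Rightarrow> 'a::field_char_0" where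
  "b_coeff m = h_fun m 0"

definition u_fun :: "nat \<Rightarrow> 'a::field_char_0 \<Rightarrow> 'a" where
  "u_fun N x = x * h_fun (N + 1) (1 + x)"

definition v_fun :: "nat \<Rightarrow> 'a::field_char_0 \<Rightarrow> 'a" where
  "v_fun N x = (1 + x) * h_fun N (1 + x)"

definition u_star :: "nat \<Rightarrow> 'a::field_char_0 \<Rightarrow> 'a" where
  "u_star N x = x ^ (N + 1) * u_fun N (1 / x)"

definition v_star :: "nat \<Rightarrow> 'a::field_char_0 \<Rightarrow> 'a" where
  "v_star N x = x ^ (N + 1) * v_fun N (1 / x)"

definition W_fun :: "nat \<Rightarrow> 'a::field_char_0 \<Rightarrow> 'a \<Rightarrow> 'a" where
  "W_fun N x y = u_fun N x * v_fun N y - u_fun N y * v_fun N x"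

definition W_star :: "nat \<Rightarrow> 'a::field_char_0 \<Rightarrow> 'a \<Rightarrow> 'a" where
  "W_star N x y = u_star N x * v_star N y - u_star N y * v_star N x"

definition H_fun :: "nat \<Rightarrow> 'a::field_char_0 \<Rightarrow> 'a \<Rightarrow> 'a" where
  "H_fun N x y = W_fun N x y * W_star N x y
     / ((b_coeff (N + 1))\<^sup>2 * (y - x) * (1 + x + x * y) * (1 + y + x * y))"

definition C_fun :: "nat \<Rightarrow> 'a::field_char_0 \<Rightarrow> 'a \<Rightarrow> 'a" where
  "C_fun N x y = H_fun N x y - x ^ (2 * N) / (1 + y + x * y) + y ^ (2 * N) / (1 + x + x * y)"

text \<open>
  \<open>\<rat>(x, y)\<close> is the fraction field of \<open>\<rat>[x][y]\<close>. It is of characteristic zero as a linearly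
  ordered field, hence \<open>of_rat\<close> is the embedding of the constants.
\<close>

type_synonym ratfun2 = "rat poly poly fract"

definition indet_x :: ratfun2 where
  "indet_x = to_fract [:[:0, 1:]:]"

definition indet_y :: ratfun2 where
  "indet_y = to_fract [:0, 1:]"

definition C_mat :: "nat \<Rightarrow> rat mat" where
  "C_mat N = (THE C. C \<in> carrier_mat (2 * N) (2 * N) \<and>
     C_fun N indet_x indet_y =
       (\<Sum>i<2 * N. \<Sum>j<2 * N. of_rat (C $$ (i, j)) * indet_x ^ i * indet_y ^ j))"

end

theory Submission
  imports Defs "Jordan_Normal_Form.Determinant"
begin

text \<open>
  Let \<open>q = 2 N\<close> and identify a vector with the polynomial of degree below \<open>q\<close> having these coefficients.
  Then \<open>G R\<close> maps \<open>f\<close> to the truncation of \<open>- (1 + x)\<^bsup>-q\<^esup> f(- 1 - x)\<close> modulo \<open>x\<^sup>q\<close>, and its transpose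
  \<open>R G\<close> maps \<open>f\<close> to the polynomial part of \<open>x\<^sup>q (1 + x)\<^bsup>-1\<^esup> f(- x / (1 + x))\<close>. The generating function of
  \<open>J - C\<close> collapses to
  \<open>K = - (b\<^sup>2 (1 + x)\<^sup>q (1 + y)\<^sup>q (y - x)\<^sup>2 + W W\<^sup>*) / (b\<^sup>2 (y - x) (1 + x + x y) (1 + y + x y))\<close>,
  and the claim says that \<open>\<Omega>\<close> maps \<open>K(_, y)\<close> to \<open>\<Sum>i<q. (x y)\<^sup>i\<close>.

  Two identities for the hypergeometric polynomials \<open>h\<^sub>m\<close> make this work. A three-term connection formula
  between \<open>z\<close>, \<open>1 - z\<close> and \<open>- z / (1 - z)\<close> expresses \<open>G R K(_, y)\<close> and \<open>R G K(_, y)\<close> in closed form.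
  A Casoratian identity for \<open>h\<^sub>N\<close> and \<open>h\<^sub>N\<^sub>+\<^sub>1\<close>, which follows from the connection formula by comparing
  degrees, shows that the denominators divide the numerators.

  Working over \<open>\<rat>(x, y)\<close>, the equation \<open>\<Omega> K(_, y) = (y\<^sup>i)\<^sub>i\<close> forces \<open>\<Omega>\<close> to be invertible because \<open>y\<close> is
  transcendental over \<open>\<rat>\<close>, and then identifies \<open>K\<close> as the generating function of its inverse.
\<close>

subsection \<open>The hypergeometric polynomials\<close>

text \<open>The index is shifted: \<open>h_poly n\<close> is the polynomial \<open>h\<^bsub>n+1\<^esub>\<close>, which has degree \<open>n\<close>.\<close>

definition h_coeff :: "nat \<Rightarrow> nat \<Rightarrow> 'a::field_char_0" where
  "h_coeff n a = (if a \<le> n then of_nat ((n + a) choose n) * of_nat ((2 * n - a) choose n)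
     / of_nat ((3 * n + 1) choose n) else 0)"

definition h_poly :: "nat \<Rightarrow> 'a::field_char_0 poly" where
  "h_poly n = (\<Sum>a\<le>n. monom (h_coeff n a) a)"

lemma coeff_h_poly [simp]: "coeff (h_poly n) a = h_coeff n a"
  by (simp add: h_poly_def coeff_sum h_coeff_def)

lemma poly_h_poly: "poly (h_poly n) z = h_fun (Suc n) z"
  unfolding h_poly_def h_fun_def h_coeff_def poly_sum poly_monom
  by (rule sum.cong) (auto simp: algebra_simps)

lemma degree_h_poly_le: "degree (h_poly n) \<le> n"
  by (rule degree_le) (simp add: h_coeff_def)

lemma h_coeff_sym: "a \<le> n \<Longrightarrow> h_coeff n (n - a) = h_coeff n a"
proof -
  assume a: "a \<le> n"
  have "n + (n - a) = 2 * n - a" "2 * n - (n - a) = n + a" using a by auto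
  thus ?thesis using a by (simp add: h_coeff_def)
qed

lemma h_coeff_0_nonzero: "h_coeff n 0 \<noteq> (0::'a::field_char_0)"
  by (simp add: h_coeff_def binomial_eq_0_iff)

text \<open>This term ratio identifies \<open>h_poly n\<close> as a multiple of the hypergeometric
  polynomial \<open>2F1(-n, n+1; -2n; z)\<close>. For \<open>a \<ge> n\<close> both sides
  vanish.\<close>

lemma h_coeff_rec:
  "of_nat (Suc a) * (2 * of_nat n - of_nat a) * h_coeff n (Suc a)
     = (of_nat n - of_nat a) * (of_nat n + of_nat a + 1) * (h_coeff n a :: 'a::field_char_0)"
proof (cases "a < n")
  case True
  have 1: "Suc a * ((n + Suc a) choose n) = (n + a + 1) * ((n + a) choose n)"
    using binomial_absorb_comp[of "n + Suc a" n] by simp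
  obtain d where d: "n = Suc (a + d)" using True less_imp_Suc_add by blast
  have 2: "(2 * n - a) * ((2 * n - Suc a) choose n) = (n - a) * ((2 * n - a) choose n)"
    using binomial_absorb_comp[of "2 * n - a" n] d by simp
  have e1: "of_nat (Suc a) * of_nat ((n + Suc a) choose n)
      = (of_nat n + of_nat a + 1) * (of_nat ((n + a) choose n) :: 'a)"
    using arg_cong[OF 1, of "of_nat :: nat \<Rightarrow> 'a"] by (simp only: of_nat_mult of_nat_add of_nat_1)
  have e2: "(2 * of_nat n - of_nat a) * of_nat ((2 * n - Suc a) choose n)
      = (of_nat n - of_nat a) * (of_nat ((2 * n - a) choose n) :: 'a)"
    using arg_cong[OF 2, of "of_nat :: nat \<Rightarrow> 'a"] True by (simp add: of_nat_diff)
  have "of_nat (Suc a) * (2 * of_nat n - of_nat a) * h_coeff n (Suc a) =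
     (of_nat (Suc a) * of_nat ((n + Suc a) choose n)) *
     ((2 * of_nat n - of_nat a) * of_nat ((2 * n - Suc a) choose n))
      / (of_nat ((3 * n + 1) choose n) :: 'a)"
    using True by (simp add: h_coeff_def)
  also have "\<dots> = (of_nat n - of_nat a) * (of_nat n + of_nat a + 1) * h_coeff n a"
    unfolding e1 e2 using True by (simp add: h_coeff_def)
  finally show ?thesis .
qed (auto simp: h_coeff_def)

text \<open>Compare the coefficients of \<open>t^m\<close> in the product of
  \<open>(1-t)^-(j+1)\<close> and \<open>(1-t)^-(k+1)\<close>; the inductions on \<open>k\<close>
  and \<open>m\<close> use Pascal's rule.\<close>

lemma sum_binomial_convolution:
  "(\<Sum>a\<le>m. ((j + a) choose j) * ((k + (m - a)) choose k)) = ((j + k + m + 1) choose m)"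
proof (induction k arbitrary: m)
  case 0
  have "(\<Sum>a\<le>m. (j + a) choose j) = (\<Sum>a\<le>m. (j + a) choose a)"
    by (intro sum.cong refl) (metis add_diff_cancel_left' binomial_symmetric le_add1)
  thus ?case using sum_choose_lower[of j m] by simp
next
  case (Suc k)
  show ?case
  proof (induction m)
    case (Suc m)
    have "(\<Sum>a\<le>Suc m. ((j + a) choose j) * ((Suc k + (Suc m - a)) choose Suc k)) =
       (\<Sum>a\<le>m. ((j + a) choose j) * ((Suc k + (Suc m - a)) choose Suc k)) + ((j + Suc m) choose j)"
      by simp
    also have "(\<Sum>a\<le>m. ((j + a) choose j) * ((Suc k + (Suc m - a)) choose Suc k)) =
       (\<Sum>a\<le>m. ((j + a) choose j) * ((k + (Suc m - a)) choose k) + ((j + a) choose j) * ((Suc k + (m - a)) choose Suc k))"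
      by (intro sum.cong refl) (simp add: Suc_diff_le algebra_simps)
    also have "\<dots> + ((j + Suc m) choose j) = (\<Sum>a\<le>Suc m. ((j + a) choose j) * ((k + (Suc m - a)) choose k))
       + (\<Sum>a\<le>m. ((j + a) choose j) * ((Suc k + (m - a)) choose Suc k))"
      by (simp add: sum.distrib)
    also have "\<dots> = ((j + Suc k + Suc m + 1) choose Suc m)"
      unfolding Suc.IH \<open>\<And>m. _ = ((j + k + m + 1) choose m)\<close> by simp
    finally show ?case .
  qed simp
qed

text \<open>The denominator in \<open>h_coeff\<close> is exactly the convolution sum of the
  numerators.\<close>

lemma poly_h_poly_1: "poly (h_poly n) 1 = (1::'a::field_char_0)"
proof -
  have "poly (h_poly n) (1::'a) =
      (\<Sum>a\<le>n. of_nat (((n + a) choose n) * ((n + (n - a)) choose n)) / of_nat ((3 * n + 1) choose n))"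
    unfolding h_poly_def poly_sum
    by (intro sum.cong refl) (simp add: h_coeff_def poly_monom mult_2)
  also have "\<dots> = of_nat (\<Sum>a\<le>n. ((n + a) choose n) * ((n + (n - a)) choose n)) / of_nat ((3 * n + 1) choose n)"
    by (simp add: sum_divide_distrib)
  also have "\<dots> = 1"
    unfolding sum_binomial_convolution by (simp add: binomial_eq_0_iff mult_2 flip: mult_2)
  finally show ?thesis .
qed

text \<open>The coefficient sequence is palindromic by \<open>h_coeff_sym\<close>.\<close>

lemma poly_h_poly_reciprocal:
  assumes "z \<noteq> 0"
  shows "z ^ n * poly (h_poly n) (1 / z) = poly (h_poly n) (z :: 'a::field_char_0)"
proof -
  have "z ^ n * poly (h_poly n) (1 / z) = (\<Sum>a\<le>n. h_coeff n a * z ^ (n - a))"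
    unfolding h_poly_def poly_sum sum_distrib_left
    by (intro sum.cong refl) (use assms in \<open>simp add: poly_monom power_diff power_divide\<close>)
  also have "\<dots> = (\<Sum>a\<le>n. h_coeff n (n - a) * z ^ (n - a))"
    by (intro sum.cong refl) (simp add: h_coeff_sym)
  also have "\<dots> = (\<Sum>a\<le>n. h_coeff n a * z ^ a)"
    by (rule sum.reindex_bij_witness[of _ "\<lambda>a. n - a" "\<lambda>a. n - a"]) auto
  finally show ?thesis by (simp add: h_poly_def poly_sum poly_monom)
qed

text \<open>The hypergeometric operator with parameters \<open>-n\<close>, \<open>-3n-1\<close> and
  \<open>-2n\<close>. Its exponents are \<open>0\<close> and \<open>2n+1\<close>, both at
  \<open>0\<close> and at \<open>1\<close>, which makes it symmetric under
  \<open>z -> 1 - z\<close>.\<close>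

definition hyp_op :: "nat \<Rightarrow> 'a::field_char_0 poly \<Rightarrow> 'a poly" where
  "hyp_op n f = [:0, 1, -1:] * pderiv (pderiv f) + of_nat (2 * n) * [:-1, 2:] * pderiv f
     - of_nat (n * (3 * n + 1)) * f"

lemma hyp_op_linear:
  "hyp_op n (f + g) = hyp_op n f + hyp_op n g" "hyp_op n (f - g) = hyp_op n f - hyp_op n g"
  "hyp_op n (smult c f) = smult c (hyp_op n f)" "hyp_op n 0 = 0"
  unfolding hyp_op_def pderiv_add pderiv_diff pderiv_smult pderiv_0 mult_smult_right
    smult_diff_right smult_add_right
  by (simp_all only: algebra_simps) simp_all

lemma hyp_op_sum: "hyp_op n (sum f A) = (\<Sum>a\<in>A. hyp_op n (f a))"
  by (induction A rule: infinite_finite_induct) (simp_all add: hyp_op_linear)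

lemma coeff_hyp_op:
  "coeff (hyp_op n f) a = of_nat (Suc a) * (of_nat a - 2 * of_nat n) * coeff f (Suc a)
     - (of_nat a - of_nat n) * (of_nat a - 3 * of_nat n - 1) * coeff f a"
proof -
  have *: "hyp_op n f = pCons 0 (pderiv (pderiv f)) - pCons 0 (pCons 0 (pderiv (pderiv f)))
     - smult (of_nat (2 * n)) (pderiv f) + smult (2 * of_nat (2 * n)) (pCons 0 (pderiv f))
     - smult (of_nat (n * (3 * n + 1))) f"
    by (simp add: hyp_op_def of_nat_poly algebra_simps flip: smult_add_left)
  show ?thesis
    unfolding * by (cases a; cases "a - 1") (simp_all add: coeff_pderiv algebra_simps)
qed

text \<open>The equation is a two-term recurrence for the coefficients. Upwards from index
  \<open>0\<close> it runs until the factor \<open>a - 2n\<close> vanishes, downwards from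
  \<open>3n+1\<close> until \<open>a - n\<close> vanishes; together the two runs cover all
  indices.\<close>

lemma hyp_op_eq_0_unique:
  assumes L: "hyp_op n f = 0" and 0: "coeff f 0 = 0" and top: "\<And>a. a > 3 * n \<Longrightarrow> coeff f a = 0"
  shows "f = (0 :: 'a::field_char_0 poly)"
proof -
  have rec: "of_nat (Suc a) * (of_nat a - 2 * of_nat n) * coeff f (Suc a)
     = (of_nat a - of_nat n) * (of_nat a - 3 * of_nat n - 1) * coeff f a" for a
    using coeff_hyp_op[of n f a] L by simp
  have low: "coeff f a = 0" if "a \<le> 2 * n" for a
    using that
  proof (induction a)
    case (Suc a)
    hence "(of_nat (Suc a) * (of_nat a - of_nat (2 * n)) :: 'a) * coeff f (Suc a) = 0"
      using rec[of a] by simp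
    moreover have "(of_nat a - of_nat (2 * n) :: 'a) \<noteq> 0"
      using Suc.prems by (simp only: right_minus_eq of_nat_eq_iff)
    ultimately show ?case by (simp only: mult_eq_0_iff of_nat_eq_0_iff) auto
  qed (simp add: 0)
  have high: "coeff f (3 * n + 1 - d) = 0" if "d \<le> 2 * n" for d
    using that
  proof (induction d)
    case (Suc d)
    define a where "a = 3 * n - d"
    have a: "Suc a = 3 * n + 1 - d" "3 * n + 1 - Suc d = a" "n < a" "a < 3 * n + 1"
      using Suc.prems by (auto simp: a_def)
    have "coeff f (Suc a) = 0" unfolding a(1) using Suc by auto
    hence "(of_nat a - of_nat n) * (of_nat a - of_nat (3 * n + 1)) * coeff f a = 0"
      using rec[of a] by (simp add: algebra_simps)
    moreover have "(of_nat a - of_nat n :: 'a) \<noteq> 0" "(of_nat a - of_nat (3 * n + 1) :: 'a) \<noteq> 0"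
      using a(3,4) by (simp_all only: right_minus_eq of_nat_eq_iff)
    ultimately show ?case unfolding a(2) by (simp only: mult_eq_0_iff) auto
  qed (use top in simp)
  show ?thesis
  proof (rule poly_eqI)
    fix a
    consider "a \<le> 2 * n" | "a > 3 * n" | "n < a" "a \<le> 3 * n + 1" by linarith
    thus "coeff f a = coeff 0 a"
    proof cases
      case 3
      thus ?thesis using high[of "3 * n + 1 - a"] by simp
    qed (use low top in auto)
  qed
qed

lemma smult_of_nat: "smult (of_nat k) p = of_nat k * (p :: 'a::comm_semiring_1 poly)"
  by (simp add: of_nat_poly)

lemma hyp_op_alt:
  fixes f :: "'a::field_char_0 poly"
  defines "Z \<equiv> [:0, 1:]"
  shows "hyp_op n f = Z * (1 - Z) * pderiv (pderiv f) + 2 * of_nat n * (2 * Z - 1) * pderiv f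
     - of_nat n * (3 * of_nat n + 1) * f"
proof -
  have "[:0, 1, -1:] = Z * (1 - Z)" "[:-1, 2:] = 2 * Z - 1"
    by (simp_all add: Z_def one_pCons numeral_poly)
  thus ?thesis unfolding hyp_op_def by (simp only: of_nat_mult of_nat_add of_nat_numeral of_nat_1)
qed

text \<open>Under \<open>z -> 1 - z\<close> the factor \<open>z (1 - z)\<close> is invariant, while
  \<open>2z - 1\<close> and the first derivative both change sign.\<close>

lemma hyp_op_reflect: "hyp_op n (pcompose f [:1, -1:]) = pcompose (hyp_op n f) [:1, -1:]"
proof -
  have 1: "pcompose [:0, 1, -1:] [:1, -1:] = [:0, 1, -1 :: 'a:]" "pcompose [:-1, 2:] [:1, -1:] = - [:-1, 2 :: 'a:]"
    by (simp_all add: pcompose_pCons)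
  have 2: "pcompose (of_nat k) r = of_nat k" for k and r :: "'a poly"
    by (simp add: of_nat_poly)
  have 3: "pderiv (pcompose g [:1, -1:]) = - pcompose (pderiv g) [:1, -1 :: 'a:]" for g
    by (simp add: pderiv_pcompose pderiv_pCons)
  show ?thesis
    unfolding hyp_op_def pcompose_add pcompose_diff pcompose_mult 1 2 3 pderiv_minus
    by (simp only: mult_minus_left mult_minus_right minus_minus)
qed

text \<open>Euler's transformation: the factor \<open>(1 - z)^(2n+1)\<close> carries the equation of
  \<open>2F1(-n, n+1; -2n; z)\<close> to that of \<open>hyp_op n\<close>.\<close>

lemma hyp_op_h_poly:
  "hyp_op n ([:1, -1:] ^ (2 * n + 1) * h_poly n) = (0 :: 'a::field_char_0 poly)"
proof -
  define Z :: "'a poly" where "Z = [:0, 1:]"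
  define h where "h = (h_poly n :: 'a poly)"
  define w :: "'a poly" where "w = [:1, -1:] ^ (2 * n + 1)"
  have Z1: "[:1, -1:] = 1 - Z" by (simp add: Z_def one_pCons)
  have dZ: "pderiv Z = 1" by (simp add: Z_def pderiv_pCons one_pCons)
  have w1: "(1 - Z) * pderiv w = - (2 * of_nat n + 1) * w"
  proof -
    have *: "pderiv w = - (2 * of_nat n + 1) * (1 - Z) ^ (2 * n)"
      unfolding w_def Z1 Suc_eq_plus1[symmetric] pderiv_power_Suc smult_of_nat
      by (simp add: dZ pderiv_diff algebra_simps)
    show ?thesis unfolding * unfolding w_def Z1 by (simp add: algebra_simps)
  qed
  have w2: "(1 - Z) * pderiv (pderiv w) = - 2 * of_nat n * pderiv w"
  proof -
    have "pderiv ((1 - Z) * pderiv w) = pderiv (- (2 * of_nat n + 1) * w)" by (simp only: w1)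
    also have "pderiv (- (2 * of_nat n + 1 :: 'a poly)) = 0"
      by (simp add: pderiv_minus pderiv_diff pderiv_add pderiv_mult)
    hence "pderiv (- (2 * of_nat n + 1) * w) = - (2 * of_nat n + 1) * pderiv w"
      by (simp only: pderiv_mult) simp
    finally show ?thesis by (simp add: pderiv_mult pderiv_diff dZ algebra_simps)
  qed
  \<comment> \<open>This is the differential form of \<open>h_coeff_rec\<close>.\<close>
  have ode: "Z * (1 - Z) * pderiv (pderiv h) - 2 * (of_nat n + Z) * pderiv h
      + of_nat n * (of_nat n + 1) * h = 0"
  proof (rule poly_eqI)
    fix a
    have *: "Z * (1 - Z) * pderiv (pderiv h) - 2 * (of_nat n + Z) * pderiv h
       + of_nat n * (of_nat n + 1) * h = pCons 0 (pderiv (pderiv h)) - pCons 0 (pCons 0 (pderiv (pderiv h)))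
       - smult (2 * of_nat n) (pderiv h) - smult 2 (pCons 0 (pderiv h))
       + smult (of_nat n * (of_nat n + 1)) h"
      by (simp add: Z_def of_nat_poly numeral_poly algebra_simps flip: smult_add_left)
    have "coeff (pCons 0 (pderiv (pderiv h)) - pCons 0 (pCons 0 (pderiv (pderiv h)))
       - smult (2 * of_nat n) (pderiv h) - smult 2 (pCons 0 (pderiv h))
       + smult (of_nat n * (of_nat n + 1)) h) a = - (of_nat (Suc a) * (2 * of_nat n - of_nat a) * coeff h (Suc a))
      + (of_nat n - of_nat a) * (of_nat n + of_nat a + 1) * coeff h a"
      by (cases a; cases "a - 1") (simp_all add: coeff_pderiv algebra_simps)
    thus "coeff (Z * (1 - Z) * pderiv (pderiv h) - 2 * (of_nat n + Z) * pderiv h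
       + of_nat n * (of_nat n + 1) * h) a = coeff 0 a"
      unfolding * unfolding h_def coeff_h_poly h_coeff_rec by simp
  qed
  \<comment> \<open>Since \<open>w1\<close> and \<open>w2\<close> express derivatives of
    \<open>w\<close> only after multiplication by \<open>1 - Z\<close>, that factor is carried along
    and cancelled at the end.\<close>
  have "(1 - Z) * hyp_op n (w * h) = 0"
    unfolding hyp_op_alt pderiv_mult pderiv_add Z_def[symmetric]
    using w1 w2 ode by Groebner_Basis.algebra
  moreover have "1 - Z \<noteq> 0" by (simp add: Z_def one_pCons)
  ultimately show ?thesis unfolding w_def h_def by simp
qed

text \<open>This is \<open>(1 - z)\<^sup>n h(- z / (1 - z))\<close>.\<close>

definition h_hom :: "nat \<Rightarrow> 'a::field_char_0 poly" where
  "h_hom n = (\<Sum>a\<le>n. smult (h_coeff n a) ([:0, -1:] ^ a * [:1, -1:] ^ (n - a)))"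

text \<open>Pfaff's transformation. The operator, multiplied by \<open>z (1 - z)\<close>, sends each
  summand to a difference of two consecutive terms, so the sum telescopes.\<close>

lemma hyp_op_h_hom: "hyp_op n (h_hom n) = (0 :: 'a::field_char_0 poly)"
proof -
  define Z :: "'a poly" where "Z = [:0, 1:]"
  define t where "t a = (- Z) ^ a * (1 - Z) ^ (n - a)" for a
  have Z1: "[:1, -1:] = 1 - Z" "[:0, -1:] = - Z" by (simp_all add: Z_def one_pCons)
  have dZ: "pderiv Z = 1" by (simp add: Z_def pderiv_pCons one_pCons)
  have pw: "Z * pderiv ((- Z) ^ a) = of_nat a * (- Z) ^ a" for a
  proof (cases a)
    case (Suc b)
    show ?thesis unfolding Suc pderiv_power_Suc smult_of_nat pderiv_minus dZ unfolding power_Suc by simp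
  qed simp
  have pw': "(1 - Z) * pderiv ((1 - Z) ^ a) = - of_nat a * (1 - Z) ^ a" for a
  proof (cases a)
    case (Suc b)
    show ?thesis unfolding Suc pderiv_power_Suc smult_of_nat pderiv_diff dZ pderiv_1 unfolding power_Suc of_nat_Suc by Groebner_Basis.algebra
  qed simp
  have t1: "Z * (1 - Z) * pderiv (t a) = (of_nat a - of_nat n * Z) * t a" if "a \<le> n" for a
  proof -
    have "Z * (1 - Z) * (p * s' + s * p') = (k - m * Z) * (p * s)"
      if "Z * p' = k * p" "(1 - Z) * s' = - (m - k) * s" for p s p' s' k m :: "'a poly"
      using that by Groebner_Basis.algebra
    from this[OF pw[of a] pw'[of "n - a", unfolded of_nat_diff[OF that]]]
    show ?thesis by (simp only: t_def pderiv_mult)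
  qed
  have t2: "Z * (1 - Z) * (Z * (1 - Z) * pderiv (pderiv (t a))) =
     ((of_nat a - of_nat n * Z)\<^sup>2 - of_nat n * Z * (1 - Z) - (1 - 2 * Z) * (of_nat a - of_nat n * Z)) * t a"
    if "a \<le> n" for a
  proof -
    have "pderiv (Z * (1 - Z) * pderiv (t a)) = pderiv ((of_nat a - of_nat n * Z) * t a)"
      by (simp only: t1[OF that])
    hence "(1 - 2 * Z) * pderiv (t a) + Z * (1 - Z) * pderiv (pderiv (t a)) =
       (of_nat a - of_nat n * Z) * pderiv (t a) - of_nat n * t a"
      by (simp add: pderiv_mult pderiv_diff dZ algebra_simps)
    thus ?thesis using t1[OF that] by Groebner_Basis.algebra
  qed
  \<comment> \<open>The telescoping weights: by \<open>h_coeff_rec\<close>, \<open>e (Suc a)\<close>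
    equals \<open>(n - a) (n + a + 1) h_coeff n a\<close>, and \<open>e\<close> vanishes at
    \<open>0\<close> and at \<open>n + 1\<close>.\<close>
  define e where "e a = (of_nat a * (2 * of_nat n + 1 - of_nat a) * h_coeff n a :: 'a)" for a
  have step: "Z * (1 - Z) * hyp_op n (smult (h_coeff n a) (t a)) =
     smult (e (Suc a)) ((1 - Z) * t (Suc a)) - smult (e a) ((1 - Z) * t a)" if "a \<le> n" for a
  proof -
    have 1: "Z * (1 - Z) * hyp_op n (t a) = (of_nat a * (of_nat a - 2 * of_nat n - 1) * (1 - Z)
        - (of_nat n - of_nat a) * (of_nat n + of_nat a + 1) * Z) * t a"
      unfolding hyp_op_alt Z_def[symmetric] using t1[OF that] t2[OF that] by Groebner_Basis.algebra
    have r: "e (Suc a) = (of_nat n - of_nat a) * (of_nat n + of_nat a + 1) * h_coeff n a"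
      using h_coeff_rec[of a n, where ?'a = 'a] by (simp add: e_def algebra_simps)
    \<comment> \<open>For \<open>a = n\<close> the truncated exponent \<open>n - Suc a\<close>
      breaks the relation between consecutive \<open>t\<close>, but then
      \<open>e (Suc a) = 0\<close>.\<close>
    have 3: "smult (e (Suc a)) ((1 - Z) * t (Suc a)) = - smult (e (Suc a)) (Z * t a)"
    proof (cases "a = n")
      case False
      hence "n - a = Suc (n - Suc a)" using that by simp
      hence "(1 - Z) * t (Suc a) = - (Z * t a)" by (simp add: t_def algebra_simps)
      thus ?thesis by (simp only: smult_minus_right)
    qed (simp add: e_def h_coeff_def)
    have s: "smult c p = [:c:] * p" for c and p :: "'a poly" by simp
    have 4: "[:e (Suc a):] = (of_nat n - of_nat a) * (of_nat n + of_nat a + 1) * [:h_coeff n a:]"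
      unfolding r by (simp add: of_nat_poly one_pCons)
    have 5: "[:e a:] = of_nat a * (2 * of_nat n + 1 - of_nat a) * [:h_coeff n a:]"
      unfolding e_def by (simp add: of_nat_poly numeral_poly one_pCons)
    show ?thesis
      unfolding 3 hyp_op_linear unfolding s 4 5 using 1 by Groebner_Basis.algebra
  qed
  have "Z * (1 - Z) * hyp_op n (h_hom n) = (\<Sum>a\<le>n. Z * (1 - Z) * hyp_op n (smult (h_coeff n a) (t a)))"
    unfolding h_hom_def hyp_op_sum Z1 t_def sum_distrib_left ..
  also have "\<dots> = (\<Sum>a\<le>n. smult (e (Suc a)) ((1 - Z) * t (Suc a)) - smult (e a) ((1 - Z) * t a))"
    by (intro sum.cong refl step) simp
  also have "\<dots> = smult (e (Suc n)) ((1 - Z) * t (Suc n)) - smult (e 0) ((1 - Z) * t 0)"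
    using sum_lessThan_telescope[of "\<lambda>a. smult (e a) ((1 - Z) * t a)" "Suc n"]
    by (simp only: lessThan_Suc_atMost)
  also have "\<dots> = 0" by (simp add: e_def h_coeff_def)
  finally have "Z * (1 - Z) * hyp_op n (h_hom n) = 0" .
  moreover have "Z \<noteq> 0" "1 - Z \<noteq> 0" by (simp_all add: Z_def one_pCons)
  ultimately show ?thesis by (metis mult_eq_0_iff)
qed

lemma degree_h_poly: "degree (h_poly n :: 'a::field_char_0 poly) = n"
  using degree_h_poly_le[of n, where ?'a = 'a] h_coeff_sym[of 0 n, where ?'a = 'a]
    h_coeff_0_nonzero[of n, where ?'a = 'a]
  by (intro antisym le_degree) auto

lemma degree_h_hom_le: "degree (h_hom n) \<le> n"
proof -
  have "degree ([:0, -1:] ^ a * [:1, -1:] ^ (n - a) :: 'a poly) \<le> n" if "a \<le> n" for a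
    using that by (simp add: degree_mult_eq degree_power_eq)
  thus ?thesis unfolding h_hom_def
    by (intro degree_sum_le) (auto intro: order.trans[OF degree_smult_le])
qed

lemma poly_h_hom:
  assumes "t \<noteq> 1"
  shows "poly (h_hom n) t = (1 - t) ^ n * poly (h_poly n) (- t / (1 - t))"
proof -
  have t: "1 - t \<noteq> 0" using assms by simp
  have "(1 - t) ^ n * poly (h_poly n) (- t / (1 - t)) =
      (\<Sum>a\<le>n. h_coeff n a * ((- t) ^ a * (1 - t) ^ (n - a)))"
    unfolding h_poly_def poly_sum sum_distrib_left
    by (intro sum.cong refl) (simp only: poly_monom power_diff[OF t] power_divide atMost_iff, simp)
  also have "\<dots> = poly (h_hom n) t"
    by (simp add: h_hom_def poly_sum)
  finally show ?thesis ..
qed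

text \<open>Both sides and the reflection of the first summand solve the hypergeometric equation
  \<open>hyp_op n f = 0\<close>, whose exponents at infinity are \<open>n\<close> and \<open>3 * n + 1\<close>.\<close>

lemma h_poly_connection:
  "[:1, -1:] ^ (2 * n + 1) * h_poly n + smult ((-1) ^ n) ([:0, 1:] ^ (2 * n + 1) * pcompose (h_poly n) [:1, -1:])
     = (h_hom n :: 'a::field_char_0 poly)"
proof -
  define A where "A = ([:1, -1:] ^ (2 * n + 1) * h_poly n :: 'a poly)"
  define B where "B = pcompose A [:1, -1:]"
  have "pcompose ([:1, -1:] ^ k) [:1, -1:] = [:0, 1 :: 'a:] ^ k" for k
  proof (induction k)
    case (Suc k)
    have "pcompose [:1, -1:] [:1, -1:] = [:0, 1 :: 'a:]" by (simp add: pcompose_pCons)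
    thus ?case by (simp only: power_Suc pcompose_mult Suc)
  qed (simp add: pcompose_1)
  hence B: "B = [:0, 1:] ^ (2 * n + 1) * pcompose (h_poly n) [:1, -1:]"
    unfolding B_def A_def pcompose_mult by (simp only:)
  have degA: "degree A = 3 * n + 1"
  proof -
    have "h_poly n \<noteq> (0 :: 'a poly)"
      using h_coeff_0_nonzero[of n, where ?'a = 'a] by (metis coeff_0 coeff_h_poly)
    moreover have "[:1, -1 :: 'a:] ^ (2 * n + 1) \<noteq> 0" by (simp only: power_eq_0_iff) simp
    ultimately have "degree A = degree ([:1, -1 :: 'a:] ^ (2 * n + 1)) + n"
      unfolding A_def by (subst degree_mult_eq) (simp_all only: degree_h_poly not_False_eq_True)
    also have "degree ([:1, -1 :: 'a:] ^ (2 * n + 1)) = 2 * n + 1"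
      by (subst degree_power_eq) simp_all
    finally show ?thesis by simp
  qed
  have degB: "degree B = 3 * n + 1" by (simp add: B_def degree_pcompose degA)
  have "lead_coeff B = lead_coeff A * (-1) ^ (3 * n + 1)"
    unfolding B_def by (subst lead_coeff_comp) (simp_all add: degA)
  \<comment> \<open>The sign \<open>(-1)^n\<close> makes the terms of degree \<open>3n+1\<close>
    cancel, as \<open>hyp_op_eq_0_unique\<close> requires.\<close>
  hence top: "coeff A (3 * n + 1) + (-1) ^ n * coeff B (3 * n + 1) = 0"
    unfolding degA degB by (simp add: power_mult flip: power_add power_mult_distrib)
  have A0: "hyp_op n A = 0" unfolding A_def by (rule hyp_op_h_poly)
  have B0: "hyp_op n B = 0" unfolding B_def hyp_op_reflect A0 by simp
  have c0: "coeff (h_hom n) 0 = (h_coeff n 0 :: 'a)"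
    using poly_h_hom[of "0 :: 'a" n] by (simp add: poly_0_coeff_0)
  have "A + smult ((-1) ^ n) B - h_hom n = 0"
  proof (rule hyp_op_eq_0_unique)
    show "hyp_op n (A + smult ((-1) ^ n) B - h_hom n) = 0"
      by (simp add: hyp_op_linear A0 B0 hyp_op_h_hom)
    show "coeff (A + smult ((-1) ^ n) B - h_hom n) 0 = 0"
      unfolding A_def B by (simp add: c0 flip: poly_0_coeff_0) (simp add: poly_0_coeff_0 c0)
    fix a assume a: "a > 3 * n"
    have "coeff (h_hom n :: 'a poly) a = 0"
      using a degree_h_hom_le[of n, where ?'a = 'a] by (intro coeff_eq_0) linarith
    moreover have "coeff A a + (-1) ^ n * coeff B a = 0"
    proof (cases "a = 3 * n + 1")
      case False
      thus ?thesis using a degA degB by (simp add: coeff_eq_0)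
    qed (use top in simp)
    ultimately show "coeff (A + smult ((-1) ^ n) B - h_hom n) a = 0" by simp
  qed
  thus ?thesis unfolding A_def B by simp
qed

text \<open>Pairing \<open>a\<close> with \<open>n - a\<close> in the palindromic sum replaces the
  weight \<open>a\<close> by its mean \<open>n / 2\<close>.\<close>

lemma poly_pderiv_h_poly_1: "2 * poly (pderiv (h_poly n)) 1 = (of_nat n :: 'a::field_char_0)"
proof -
  have "poly (pderiv (h_poly n)) (1::'a) = (\<Sum>a\<le>n. of_nat a * h_coeff n a)"
  proof -
    have "pderiv (sum f A) = (\<Sum>a\<in>A. pderiv (f a))" for f :: "nat \<Rightarrow> 'a poly" and A
      by (induction A rule: infinite_finite_induct) (simp_all add: pderiv_add)
    thus ?thesis unfolding h_poly_def by (simp add: poly_sum pderiv_monom poly_monom)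
  qed
  moreover have "(\<Sum>a\<le>n. of_nat a * h_coeff n a) = (\<Sum>a\<le>n. of_nat (n - a) * h_coeff n a :: 'a)"
    by (rule sum.reindex_bij_witness[of _ "\<lambda>a. n - a" "\<lambda>a. n - a"]) (auto simp: h_coeff_sym)
  ultimately have "2 * poly (pderiv (h_poly n)) (1::'a) =
      (\<Sum>a\<le>n. of_nat a * h_coeff n a) + (\<Sum>a\<le>n. of_nat (n - a) * h_coeff n a)"
    by simp
  also have "\<dots> = (\<Sum>a\<le>n. of_nat n * h_coeff n a)"
    by (simp add: sum.distrib[symmetric]) (intro sum.cong refl, simp add: algebra_simps of_nat_diff)
  also have "\<dots> = of_nat n * poly (h_poly n) 1"
    by (simp add: h_poly_def poly_sum poly_monom sum_distrib_left)
  finally show ?thesis by (simp add: poly_h_poly_1)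
qed

text \<open>After multiplication by \<open>(1 - z)^(2n+1)\<close>, the left side can be rewritten
  with the connection formulas for \<open>n\<close> and \<open>n + 1\<close>, whose terms in
  \<open>z^(2n+1)\<close> cancel because their signs alternate. The resulting degree bound
  \<open>2n+3\<close> leaves a quadratic, fixed by its values at \<open>0\<close> and
  \<open>1\<close> and its slope at \<open>0\<close>.\<close>

lemma h_poly_casoratian:
  "[:0, 1:]\<^sup>2 * pcompose (h_poly (Suc n)) [:1, -1:] * h_poly n
     + [:1, -1:]\<^sup>2 * h_poly (Suc n) * pcompose (h_poly n) [:1, -1:]
   = smult (h_coeff (Suc n) 0) [:1, -1, 1 :: 'a::field_char_0:]"
proof -
  define h g hr gr :: "'a poly" where "h = h_poly (Suc n)" and "g = h_poly n"
    and "hr = pcompose (h_poly (Suc n)) [:1, -1:]" and "gr = pcompose (h_poly n) [:1, -1:]"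
  define F where "F = [:0, 1:]\<^sup>2 * hr * g + [:1, -1:]\<^sup>2 * h * gr"
  define b where "b = (h_coeff (Suc n) 0 :: 'a)"
  have "a * (Z\<^sup>2 * hr * g + V\<^sup>2 * h * gr) = P * gr + Z\<^sup>2 * Q * hr"
    if "V\<^sup>2 * a * h + - s * (Z\<^sup>2 * c * hr) = P" "a * g + s * (c * gr) = Q" for V a s Z c P Q
    unfolding that[symmetric] by Groebner_Basis.algebra
  note alg = this[of "[:1, -1:]" "[:1, -1:] ^ (2 * n + 1)" "[:(-1) ^ n:]" "[:0, 1:]" "[:0, 1:] ^ (2 * n + 1)"
      "h_hom (Suc n)" "h_hom n", folded F_def]
  have key: "[:1, -1:] ^ (2 * n + 1) * F = h_hom (Suc n) * gr + [:0, 1:]\<^sup>2 * h_hom n * hr"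
  proof (rule alg)
    have "[:1, -1:]\<^sup>2 * [:1, -1:] ^ (2 * n + 1) = [:1, -1 :: 'a:] ^ (2 * Suc n + 1)"
      "[:0, 1:]\<^sup>2 * [:0, 1:] ^ (2 * n + 1) = [:0, 1 :: 'a:] ^ (2 * Suc n + 1)"
      unfolding power_add[symmetric] by simp_all
    thus "[:1, -1:]\<^sup>2 * [:1, -1:] ^ (2 * n + 1) * h + - [:(-1) ^ n:] * ([:0, 1:]\<^sup>2 * [:0, 1:] ^ (2 * n + 1) * hr) = h_hom (Suc n)"
      using h_poly_connection[of "Suc n", where ?'a = 'a] unfolding h_def hr_def by simp
    show "[:1, -1:] ^ (2 * n + 1) * g + [:(-1) ^ n:] * ([:0, 1:] ^ (2 * n + 1) * gr) = h_hom n"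
      using h_poly_connection[of n, where ?'a = 'a] unfolding g_def gr_def by simp
  qed
  have degs: "degree gr = n" "degree hr = Suc n"
    by (simp_all add: gr_def hr_def degree_pcompose degree_h_poly)
  have "degree (h_hom (Suc n) * gr + [:0, 1:]\<^sup>2 * h_hom n * hr) \<le> 2 * n + 3"
    using degree_h_hom_le[of n, where ?'a = 'a] degree_h_hom_le[of "Suc n", where ?'a = 'a]
    by (intro degree_add_le order.trans[OF degree_mult_le] order.trans[OF add_mono[OF degree_mult_le order.refl]])
       (auto simp: degs degree_power_eq)
  hence "degree ([:1, -1:] ^ (2 * n + 1) * F) \<le> 2 * n + 3" unfolding key .
  hence degF: "degree F \<le> 2"
    by (cases "F = 0") (simp_all add: degree_mult_eq degree_power_eq del: power_Suc)
  have F: "F = [:coeff F 0, coeff F 1, coeff F 2:]"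
  proof (rule poly_eqI)
    fix i show "coeff F i = coeff [:coeff F 0, coeff F 1, coeff F 2:] i"
      using degF coeff_eq_0[of F i] by (auto simp: coeff_pCons numeral_2_eq_2 split: nat.split)
  qed
  have v: "poly h 0 = b" "poly gr 0 = 1" "poly hr 1 = b" "poly g 1 = 1"
    by (simp_all add: h_def g_def hr_def gr_def poly_pcompose poly_h_poly_1 b_def poly_0_coeff_0)
  have f0: "coeff F 0 = b"
    unfolding poly_0_coeff_0[symmetric] F_def by (simp add: v)
  have "poly F 1 = b" unfolding F_def by (simp add: v)
  hence f2: "coeff F 0 + coeff F 1 + coeff F 2 = b" by (subst (asm) F) (simp add: add.assoc)
  have h1: "2 * coeff h 1 = (of_nat (Suc n) + 1) * b"
    using h_coeff_rec[of 0 "Suc n", where ?'a = 'a]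
    by (simp add: h_def b_def of_nat_Suc[of 0] del: of_nat_Suc)
  have gr': "poly (pderiv gr) 0 = - poly (pderiv g) 1"
    by (simp add: gr_def g_def pderiv_pcompose poly_pcompose pderiv_pCons)
  have "coeff F 1 = poly (pderiv F) 0"
    by (simp add: poly_0_coeff_0 coeff_pderiv)
  also have "\<dots> = - 2 * b + coeff h 1 - b * poly (pderiv g) 1"
    unfolding F_def
    by (simp add: pderiv_add pderiv_mult pderiv_power pderiv_pCons v gr' power2_eq_square)
       (simp add: poly_0_coeff_0 coeff_pderiv algebra_simps)
  finally have "2 * coeff F 1 = - 4 * b + 2 * coeff h 1 - b * (2 * poly (pderiv g) 1)"
    by Groebner_Basis.algebra
  also have "\<dots> = 2 * (- b)"
    unfolding h1 g_def poly_pderiv_h_poly_1 by (simp add: algebra_simps)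
  finally have f1: "coeff F 1 = - b" by simp
  have "F = [:b, -b, b:]" using f0 f1 f2 by (subst F) simp
  thus ?thesis unfolding F_def h_def g_def hr_def gr_def b_def by simp
qed

subsection \<open>The actions of \<open>G R\<close> and \<open>R G\<close> on polynomials\<close>

text \<open>For even \<open>q\<close> these are the entries of \<open>G R\<close>; the sign comes from \<open>(-1)\<^bsup>q-1\<^esup>\<close>.\<close>

definition GR_entry :: "nat \<Rightarrow> nat \<Rightarrow> nat \<Rightarrow> 'a::comm_ring_1" where
  "GR_entry q i j = - ((-1) ^ (i + j) * of_nat ((q - 1 - j + i) choose i))"

lemma coeff_one_plus_X_mult:
  "coeff ([:1, 1:] * p) i = coeff p i + (case i of 0 \<Rightarrow> 0 | Suc k \<Rightarrow> coeff p k)"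
  for p :: "'a::comm_semiring_1 poly"
  by (simp add: coeff_pCons split: nat.split)

text \<open>The truncation of \<open>(1 + x)\<^bsup>-(k+1)\<^esup>\<close> modulo \<open>x\<^sup>q\<close>.\<close>

definition one_plus_X_inv :: "nat \<Rightarrow> nat \<Rightarrow> 'a::comm_ring_1 poly" where
  "one_plus_X_inv q k = (\<Sum>i<q. monom ((-1) ^ i * of_nat ((k + i) choose i)) i)"

lemma coeff_one_plus_X_inv:
  "coeff (one_plus_X_inv q k) i = (if i < q then (-1) ^ i * of_nat ((k + i) choose i) else 0)"
  by (simp add: one_plus_X_inv_def coeff_sum)

lemma one_plus_X_inv:
  "monom 1 q dvd [:1, 1:] ^ Suc k * one_plus_X_inv q k - (1 :: 'a::field poly)"
proof (induction k)
  case 0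
  show ?case unfolding monom_1_dvd_iff'
    by (auto simp: coeff_one_plus_X_mult coeff_one_plus_X_inv simp del: mult_pCons_left split: nat.split)
next
  case (Suc k)
  have "monom 1 q dvd [:1, 1:] * one_plus_X_inv q (Suc k) - (one_plus_X_inv q k :: 'a poly)"
    unfolding monom_1_dvd_iff'
  proof (intro allI impI)
    fix i assume "i < q"
    thus "coeff ([:1, 1:] * one_plus_X_inv q (Suc k) - (one_plus_X_inv q k :: 'a poly)) i = 0"
      unfolding coeff_diff coeff_one_plus_X_mult coeff_one_plus_X_inv
      by (cases i) (simp_all add: algebra_simps)
  qed
  hence "monom 1 q dvd [:1, 1:] ^ Suc k * ([:1, 1:] * one_plus_X_inv q (Suc k) - one_plus_X_inv q k)
     + ([:1, 1:] ^ Suc k * one_plus_X_inv q k - (1 :: 'a poly))"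
    using Suc by (intro dvd_add dvd_mult)
  also have "[:1, 1:] ^ Suc k * ([:1, 1:] * one_plus_X_inv q (Suc k) - one_plus_X_inv q k)
     + ([:1, 1:] ^ Suc k * one_plus_X_inv q k - (1 :: 'a poly)) = [:1, 1:] ^ Suc (Suc k) * one_plus_X_inv q (Suc k) - 1"
  proof -
    have "p * (x * r' - r) + (p * r - 1) = (x * p) * r' - 1" for p x r r' :: "'a poly"
      by (simp add: algebra_simps)
    thus ?thesis by (subst power_Suc[of _ "Suc k"])
  qed
  finally show ?case .
qed

text \<open>The hypothesis on \<open>g\<close> says \<open>g = - (1 + x)^(-q) f(-1 - x)\<close>
  modulo \<open>x^q\<close>, without power series. For \<open>f = x^j\<close> the right side
  expands, by the negative binomial series, to column \<open>j\<close> of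
  \<open>GR_entry\<close>.\<close>

lemma GR_entry_action:
  fixes f g :: "'a::field poly"
  assumes f: "degree f < q" and g: "monom 1 q dvd [:1, 1:] ^ q * g + pcompose f [:-1, -1:]" and i: "i < q"
  shows "coeff g i = (\<Sum>j<q. GR_entry q i j * coeff f j)"
proof -
  \<comment> \<open>The actual image of \<open>f\<close>. It satisfies the congruence assumed of
    \<open>g\<close>, and \<open>1 + x\<close> is a unit modulo \<open>x^q\<close>.\<close>
  define g' where "g' = (\<Sum>j<q. smult (- ((-1) ^ j * coeff f j)) (one_plus_X_inv q (q - 1 - j)))"
  have q: "q > 0" using i by simp
  have coeff_g': "coeff g' i = (\<Sum>j<q. GR_entry q i j * coeff f j)"
    unfolding g'_def coeff_sum
    by (intro sum.cong refl) (use i in \<open>simp add: coeff_one_plus_X_inv GR_entry_def power_add algebra_simps\<close>)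
  have neg: "[:-1, -1:] ^ j = smult ((-1) ^ j) ([:1, 1 :: 'a:] ^ j)" for j
    using smult_power[of "-1" "[:1, 1 :: 'a:]" j] by simp
  have pow: "pcompose ([:0, 1:] ^ j) r = r ^ j" for j and r :: "'a poly"
  proof (induction j)
    case (Suc j)
    have "pcompose [:0, 1:] r = r" by (simp add: pcompose_pCons)
    thus ?case by (simp only: power_Suc pcompose_mult Suc)
  qed (simp add: pcompose_1)
  have f_sum: "pcompose f [:-1, -1:] = (\<Sum>j<q. smult (coeff f j) ([:-1, -1:] ^ j))"
  proof -
    have "f = (\<Sum>j<q. monom (coeff f j) j)"
      by (rule poly_eqI) (use f in \<open>auto simp: coeff_sum intro: coeff_eq_0\<close>)
    hence "pcompose f [:-1, -1:] = pcompose (\<Sum>j<q. monom (coeff f j) j) [:-1, -1:]" by simp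
    also have "\<dots> = (\<Sum>j<q. pcompose (monom (coeff f j) j) [:-1, -1:])" by (simp add: pcompose_sum)
    also have "\<dots> = (\<Sum>j<q. smult (coeff f j) ([:-1, -1:] ^ j))"
      by (intro sum.cong refl) (simp add: monom_altdef pcompose_smult pow)
    finally show ?thesis .
  qed
  have "[:1, 1:] ^ q * g' + pcompose f [:-1, -1:] =
     (\<Sum>j<q. smult (- ((-1) ^ j * coeff f j)) ([:1, 1:] ^ j * ([:1, 1:] ^ Suc (q - 1 - j) * one_plus_X_inv q (q - 1 - j) - 1)))"
    unfolding g'_def f_sum sum_distrib_left sum.distrib[symmetric]
  proof (intro sum.cong refl)
    fix j assume "j \<in> {..<q}"
    hence "q = j + Suc (q - 1 - j)" by auto
    hence *: "[:1, 1 :: 'a:] ^ q = [:1, 1:] ^ j * [:1, 1:] ^ Suc (q - 1 - j)" by (metis power_add)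
    show "[:1, 1:] ^ q * smult (- ((-1) ^ j * coeff f j)) (one_plus_X_inv q (q - 1 - j)) + smult (coeff f j) ([:-1, -1:] ^ j) =
      smult (- ((-1) ^ j * coeff f j)) ([:1, 1:] ^ j * ([:1, 1:] ^ Suc (q - 1 - j) * one_plus_X_inv q (q - 1 - j) - 1))"
      unfolding * neg right_diff_distrib smult_diff_right mult_smult_right
      by (simp only: mult.assoc mult_1_right smult_smult smult_minus_left diff_minus_eq_add mult.commute[of "coeff f j"])
  qed
  also have "monom 1 q dvd \<dots>"
    by (intro dvd_sum dvd_smult dvd_mult one_plus_X_inv)
  finally have "monom 1 q dvd ([:1, 1:] ^ q * g + pcompose f [:-1, -1:]) - ([:1, 1:] ^ q * g' + pcompose f [:-1, -1:])"
    using g by (rule dvd_diff[rotated])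
  hence 1: "monom 1 q dvd [:1, 1:] ^ q * (g - g')" by (simp add: algebra_simps)
  have 2: "monom 1 q dvd [:1, 1:] ^ q * one_plus_X_inv q (q - 1) - (1 :: 'a poly)"
    using one_plus_X_inv[of q "q - 1"] q by simp
  have "monom 1 q dvd one_plus_X_inv q (q - 1) * ([:1, 1:] ^ q * (g - g')) -
      ([:1, 1:] ^ q * one_plus_X_inv q (q - 1) - 1) * (g - g')"
    by (intro dvd_diff dvd_mult[OF 1] dvd_mult2[OF 2])
  also have "one_plus_X_inv q (q - 1) * ([:1, 1:] ^ q * (g - g')) -
      ([:1, 1:] ^ q * one_plus_X_inv q (q - 1) - 1) * (g - g') = g - g'"
  proof -
    have "r * (p * d) - (p * r - 1) * d = d" for p r d :: "'a poly"
      by (simp add: algebra_simps)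
    thus ?thesis .
  qed
  finally have "coeff (g - g') i = 0" using i unfolding monom_1_dvd_iff' by blast
  thus ?thesis using coeff_g' by simp
qed

text \<open>The polynomial part of \<open>x\<^bsup>q+j\<^esup> (1 + x)\<^bsup>-(j+1)\<^esup>\<close>, for even \<open>q\<close>.\<close>

definition one_plus_X_quot :: "nat \<Rightarrow> nat \<Rightarrow> 'a::comm_ring_1 poly" where
  "one_plus_X_quot q j = (\<Sum>i<q. monom ((-1) ^ Suc i * of_nat ((q - 1 - i + j) choose j)) i)"

lemma coeff_one_plus_X_quot:
  "coeff (one_plus_X_quot q j) i = (if i < q then (-1) ^ Suc i * of_nat ((q - 1 - i + j) choose j) else 0)"
  by (simp add: one_plus_X_quot_def coeff_sum)

text \<open>The step from \<open>Q_j\<close> to the next quotient is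
  \<open>(1 + x) Q_(j+1) = x Q_j + c\<close> with a constant \<open>c\<close>. Evenness of
  \<open>q\<close> makes \<open>x^q - 1\<close> divisible by \<open>1 + x\<close>, which is the case
  \<open>j = 0\<close>.\<close>

lemma one_plus_X_quot:
  assumes "even q" "q > 0"
  shows "degree ([:1, 1:] ^ Suc j * one_plus_X_quot q j - monom 1 (q + j) :: 'a::field poly) \<le> j"
proof (induction j)
  case 0
  have "[:1, 1:] * one_plus_X_quot q 0 - monom 1 q = [:-1 :: 'a:]"
    by (rule poly_eqI)
       (use assms in \<open>auto simp: coeff_one_plus_X_mult coeff_one_plus_X_quot less_Suc_eq coeff_pCons
          simp del: mult_pCons_left split: nat.split\<close>)
  thus ?case by simp
next
  case (Suc j)
  define c :: 'a where "c = - of_nat ((q + j) choose Suc j)"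
  have c: "[:1, 1:] * one_plus_X_quot q (Suc j) = pCons 0 (one_plus_X_quot q j) + [:c:]"
  proof (rule poly_eqI)
    fix i
    show "coeff ([:1, 1:] * one_plus_X_quot q (Suc j)) i = coeff (pCons 0 (one_plus_X_quot q j) + [:c:]) i"
    proof (cases i)
      case 0
      thus ?thesis using assms
        by (simp add: coeff_one_plus_X_mult coeff_one_plus_X_quot c_def del: mult_pCons_left)
    next
      case (Suc k)
      consider "i < q" | "i = q" | "i > q" by linarith
      thus ?thesis
      proof cases
        case 1
        define d where "d = q - Suc (Suc k)"
        have d: "q = Suc (Suc (k + d))" using 1 Suc by (simp add: d_def)
        show ?thesis unfolding Suc d
          by (simp add: coeff_one_plus_X_mult coeff_one_plus_X_quot algebra_simps del: mult_pCons_left)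
      next
        case 2
        hence "q = Suc k" "i = Suc k" using Suc by simp_all
        thus ?thesis using assms
          by (simp add: coeff_one_plus_X_mult coeff_one_plus_X_quot del: mult_pCons_left)
      next
        case 3
        thus ?thesis using Suc
          by (simp add: coeff_one_plus_X_mult coeff_one_plus_X_quot del: mult_pCons_left)
      qed
    qed
  qed
  have "[:1, 1:] ^ Suc (Suc j) * one_plus_X_quot q (Suc j) - monom 1 (q + Suc j)
     = [:1, 1:] ^ Suc j * ([:1, 1:] * one_plus_X_quot q (Suc j)) - monom 1 (q + Suc j)"
    by (simp only: power_Suc ac_simps)
  also have "\<dots> = pCons 0 ([:1, 1:] ^ Suc j * one_plus_X_quot q j - monom 1 (q + j)) + smult c ([:1, 1:] ^ Suc j)"
    unfolding c by (simp add: distrib_left monom_Suc del: power_Suc)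
  also have "degree \<dots> \<le> Suc j"
    using Suc by (intro degree_add_le order.trans[OF degree_smult_le])
      (auto intro: order.trans[OF degree_pCons_le] simp: degree_power_eq simp del: power_Suc)
  finally show ?case .
qed

text \<open>For \<open>degree f < q\<close> the inner sum is
  \<open>(1 + x)^(q-1) f(-x / (1 + x))\<close>. So \<open>g\<close> is the quotient of
  \<open>x^q\<close> times this sum on division by \<open>(1 + x)^q\<close>, and such a quotient is
  unique.\<close>

lemma GR_entry_transpose_action:
  fixes f g :: "'a::field poly"
  assumes q: "even q" and i: "i < q"
    and g: "degree ([:1, 1:] ^ q * g
      - monom 1 q * (\<Sum>j<q. smult (coeff f j) ([:0, -1:] ^ j * [:1, 1:] ^ (q - 1 - j)))) < q"
  shows "coeff g i = (\<Sum>j<q. GR_entry q j i * coeff f j)"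
proof -
  define g' where "g' = (\<Sum>j<q. smult ((-1) ^ j * coeff f j) (one_plus_X_quot q j))"
  define F where "F = (\<Sum>j<q. smult (coeff f j) ([:0, -1:] ^ j * [:1, 1:] ^ (q - 1 - j)))"
  have coeff_g': "coeff g' i = (\<Sum>j<q. GR_entry q j i * coeff f j)"
    unfolding g'_def coeff_sum
    by (intro sum.cong refl) (use i in \<open>simp add: coeff_one_plus_X_quot GR_entry_def power_add algebra_simps\<close>)
  have neg: "[:0, -1:] ^ j = smult ((-1) ^ j) (monom (1 :: 'a) j)" for j
    using smult_power[of "-1" "[:0, 1 :: 'a:]" j] by (simp add: monom_altdef)
  have "[:1, 1:] ^ q * g' - monom 1 q * F =
     (\<Sum>j<q. smult ((-1) ^ j * coeff f j) ([:1, 1:] ^ (q - 1 - j) * ([:1, 1:] ^ Suc j * one_plus_X_quot q j - monom 1 (q + j))))"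
    unfolding g'_def F_def sum_distrib_left sum_subtractf[symmetric]
  proof (intro sum.cong refl)
    fix j assume "j \<in> {..<q}"
    hence "q = (q - 1 - j) + Suc j" by auto
    hence *: "[:1, 1 :: 'a:] ^ q = [:1, 1:] ^ (q - 1 - j) * [:1, 1:] ^ Suc j" by (metis power_add)
    have m: "monom (1 :: 'a) (q + j) = monom 1 q * monom 1 j" by (simp add: mult_monom)
    show "[:1, 1:] ^ q * smult ((-1) ^ j * coeff f j) (one_plus_X_quot q j)
        - monom 1 q * smult (coeff f j) ([:0, -1:] ^ j * [:1, 1:] ^ (q - 1 - j)) =
      smult ((-1) ^ j * coeff f j) ([:1, 1:] ^ (q - 1 - j) * ([:1, 1:] ^ Suc j * one_plus_X_quot q j - monom 1 (q + j)))"
      unfolding * neg m right_diff_distrib smult_diff_right mult_smult_right mult_smult_left smult_smult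
      by (simp only: mult_ac)
  qed
  also have "degree \<dots> \<le> q - 1"
  proof (intro degree_sum_le order.trans[OF degree_smult_le] order.trans[OF degree_mult_le])
    fix j assume "j \<in> {..<q}"
    thus "degree ([:1, 1 :: 'a:] ^ (q - 1 - j)) + degree ([:1, 1:] ^ Suc j * one_plus_X_quot q j - monom 1 (q + j) :: 'a poly) \<le> q - 1"
      using one_plus_X_quot[of q j, where ?'a = 'a] q i by (simp add: degree_power_eq del: power_Suc)
  qed simp
  finally have g': "degree ([:1, 1:] ^ q * g' - monom 1 q * F) < q" using i by simp
  have "degree (([:1, 1:] ^ q * g - monom 1 q * F) - ([:1, 1:] ^ q * g' - monom 1 q * F)) < q"
    using g g' unfolding F_def[symmetric] by (rule degree_diff_less[of _ q])
  hence "degree ([:1, 1:] ^ q * (g - g')) < q" by (simp add: algebra_simps)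
  hence "g - g' = 0"
    by (cases "g - g' = 0") (simp_all add: degree_mult_eq degree_power_eq)
  thus ?thesis using coeff_g' by simp
qed

subsection \<open>The kernel of the inverse\<close>

lemma b_coeff_eq: "b_coeff (Suc n + 1) = h_coeff (Suc n) 0"
  by (simp add: b_coeff_def poly_0_coeff_0 flip: poly_h_poly)

lemma u_fun_eq: "u_fun (Suc n) x = x * poly (h_poly (Suc n)) (1 + x)"
  and v_fun_eq: "v_fun (Suc n) x = (1 + x) * poly (h_poly n) (1 + x)"
  by (simp_all add: u_fun_def v_fun_def poly_h_poly)

section \<open>Values of W and its starred companion on a zero set of the denominator\<close>

lemma casoratian_at:
  "z\<^sup>2 * poly (h_poly (Suc n)) (1 - z) * poly (h_poly n) z
    + (1 - z)\<^sup>2 * poly (h_poly (Suc n)) z * poly (h_poly n) (1 - z)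
   = h_coeff (Suc n) 0 * (1 - z + z\<^sup>2 :: 'a::field_char_0)"
  using arg_cong[OF h_poly_casoratian[of n, where ?'a = 'a], of "\<lambda>p. poly p z"]
  by (simp add: poly_pcompose power2_eq_square algebra_simps)

text \<open>On the curve \<open>1 + x + x y = 0\<close>, the choice \<open>z = 1 / (1 + y)\<close>
  gives \<open>1 + x = 1 - z\<close>. Reciprocity replaces \<open>h(1 + y)\<close> by
  \<open>h(z)\<close>, and what remains is the Casoratian at \<open>z\<close>.\<close>

lemma W_fun_at:
  fixes x y :: "'a::field_char_0"
  assumes "x * (1 + y) = -1"
  shows "W_fun (Suc n) x y = - h_coeff (Suc n) 0 * (1 + y) ^ n * (y\<^sup>2 + y + 1)"
proof -
  define w z where "w = 1 + y" and "z = 1 / w"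
  have w: "w \<noteq> 0" using assms by (auto simp: w_def)
  have wz: "w * z = 1" using w by (simp add: z_def)
  have x: "x = - z" "1 + x = 1 - z" and y: "y = w * (1 - z)" "1 + y = w"
    using assms w by (simp_all add: z_def w_def field_simps eq_neg_iff_add_eq_0)
  define H G H' G' where "H = poly (h_poly (Suc n)) z" and "G = poly (h_poly n) z"
    and "H' = poly (h_poly (Suc n)) (1 - z)" and "G' = poly (h_poly n) (1 - z)"
  have rec: "poly (h_poly (Suc n)) w = w ^ Suc n * H" "poly (h_poly n) w = w ^ n * G"
    using poly_h_poly_reciprocal[OF w, of "Suc n"] poly_h_poly_reciprocal[OF w, of n]
    by (simp_all add: z_def H_def G_def)
  have c: "z\<^sup>2 * H' * G + (1 - z)\<^sup>2 * H * G' = h_coeff (Suc n) 0 * (1 - z + z\<^sup>2)"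
    unfolding H_def G_def H'_def G'_def by (rule casoratian_at)
  have "W_fun (Suc n) x y = - z * H' * (w * (w ^ n * G)) - w * (1 - z) * (w ^ Suc n * H) * ((1 - z) * G')"
    unfolding W_fun_def u_fun_eq v_fun_eq x(2) y(2) rec H'_def[symmetric] G'_def[symmetric]
    by (simp only: x(1) y(1))
  also have "\<dots> = - (w ^ n) * (w * w) * (z\<^sup>2 * H' * G + (1 - z)\<^sup>2 * H * G')"
  proof -
    have "- z * H' * (w * (p * G)) - w * (1 - z) * ((w * p) * H) * ((1 - z) * G') =
      - p * (w * w) * (z\<^sup>2 * H' * G + (1 - z)\<^sup>2 * H * G')" for p
      using wz by Groebner_Basis.algebra
    thus ?thesis by (simp only: power_Suc)
  qed
  also have "\<dots> = - h_coeff (Suc n) 0 * w ^ n * (y\<^sup>2 + y + 1)"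
  proof -
    have *: "w * w * (1 - z + z\<^sup>2) = y\<^sup>2 + y + 1" using wz y by Groebner_Basis.algebra
    show ?thesis unfolding c *[symmetric] by (simp only: mult_ac mult_minus_left mult_minus_right)
  qed
  finally show ?thesis by (simp add: w_def)
qed

lemma W_star_eq: "W_star N x y = (x * y) ^ (N + 1) * W_fun N (1 / x) (1 / y)"
  unfolding W_star_def W_fun_def u_star_def v_star_def power_mult_distrib
  by (simp add: algebra_simps)

lemma W_fun_swap: "W_fun N y x = - W_fun N x y"
  by (simp add: W_fun_def)

lemma W_star_swap: "W_star N y x = - W_star N x y"
  by (simp add: W_star_def)

text \<open>The pair \<open>(1/y, 1/x)\<close> satisfies the hypothesis of \<open>W_fun_at\<close>
  again, since \<open>1/x = -(1 + y)\<close>.\<close>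

lemma W_star_at:
  fixes x y :: "'a::field_char_0"
  assumes "x * (1 + y) = -1" "y \<noteq> 0"
  shows "(1 + y) ^ (n + 2) * W_star (Suc n) x y = h_coeff (Suc n) 0 * y ^ (2 * n + 2) * (y\<^sup>2 + y + 1)"
proof -
  have y1: "1 + y \<noteq> 0" using assms by auto
  have x: "x = - 1 / (1 + y)" using assms(1) y1 by (simp add: field_simps)
  hence ix: "1 / x = - (1 + y)" using y1 by simp
  have "W_fun (Suc n) (1 / y) (1 / x) = - h_coeff (Suc n) 0 * (1 + 1 / x) ^ n * ((1 / x)\<^sup>2 + 1 / x + 1)"
    by (rule W_fun_at) (use assms in \<open>simp add: ix\<close>)
  also have "\<dots> = - h_coeff (Suc n) 0 * (- y) ^ n * (y\<^sup>2 + y + 1)"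
    unfolding ix by (simp add: power2_eq_square algebra_simps)
  finally have W: "W_fun (Suc n) (1 / x) (1 / y) = h_coeff (Suc n) 0 * (- y) ^ n * (y\<^sup>2 + y + 1)"
    by (subst W_fun_swap) simp
  have "(1 + y) * (x * y) = - y" using assms(1) by Groebner_Basis.algebra
  hence "((1 + y) * (x * y)) ^ (n + 2) = (- y) ^ (n + 2)" by (simp only:)
  hence "(1 + y) ^ (n + 2) * W_star (Suc n) x y
     = ((- y) ^ (n + 2) * (- y) ^ n) * (h_coeff (Suc n) 0 * (y\<^sup>2 + y + 1))"
    unfolding W_star_eq W by (auto simp: power_mult_distrib mult_ac)
  also have "(- y) ^ (n + 2) * (- y) ^ n = y ^ (2 * n + 2)"
  proof -
    have "(- y) ^ (n + 2) * (- y) ^ n = ((- y) ^ 2) ^ (n + 1)"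
      unfolding power_add[symmetric] power_mult[symmetric] by (rule arg_cong[where f = "power (- y)"]) simp
    also have "\<dots> = y ^ (2 * (n + 1))" unfolding power2_minus power_mult[symmetric] ..
    finally show ?thesis by simp
  qed
  finally show ?thesis by (simp add: mult_ac)
qed

definition kernel_num :: "nat \<Rightarrow> 'a::field_char_0 \<Rightarrow> 'a \<Rightarrow> 'a" where
  "kernel_num n x y = (h_coeff (Suc n) 0)\<^sup>2 * ((1 + x) * (1 + y)) ^ (2 * n + 2) * (y - x)\<^sup>2
     + W_fun (Suc n) x y * W_star (Suc n) x y"

lemma kernel_num_swap: "kernel_num n y x = kernel_num n x y"
  unfolding kernel_num_def W_fun_swap[of _ y x] W_star_swap[of _ y x]
  by (simp add: power2_commute mult_ac)

lemma kernel_num_diag: "kernel_num n y y = 0"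
  by (simp add: kernel_num_def W_fun_def)

text \<open>On this curve \<open>(1 + x) (1 + y) = y\<close> and
  \<open>(1 + y) (y - x) = y^2 + y + 1\<close>, so after multiplication by \<open>(1 + y)^2\<close>
  the two summands are opposite.\<close>

lemma kernel_num_at:
  fixes x y :: "'a::field_char_0"
  assumes "x * (1 + y) = -1" "y \<noteq> 0"
  shows "kernel_num n x y = 0"
proof -
  have y1: "1 + y \<noteq> 0" using assms by auto
  define r where "r = y\<^sup>2 + y + 1"
  have e1: "(1 + x) * (1 + y) = y" and e2: "(1 + y) * (y - x) = r"
    using assms(1) by (simp_all add: r_def algebra_simps power2_eq_square)
  have "(1 + y) ^ 2 * (W_fun (Suc n) x y * W_star (Suc n) x y) = - (h_coeff (Suc n) 0)\<^sup>2 * y ^ (2 * n + 2) * r\<^sup>2"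
  proof -
    have "(1 + y) ^ 2 * (W_fun (Suc n) x y * W_star (Suc n) x y) =
       - h_coeff (Suc n) 0 * r * ((1 + y) ^ (n + 2) * W_star (Suc n) x y)"
      unfolding W_fun_at[OF assms(1)] r_def by (simp add: power_add power2_eq_square mult_ac)
    thus ?thesis unfolding W_star_at[OF assms] r_def[symmetric] by (simp add: power2_eq_square mult_ac)
  qed
  moreover have "(1 + y) ^ 2 * ((h_coeff (Suc n) 0)\<^sup>2 * ((1 + x) * (1 + y)) ^ (2 * n + 2) * (y - x)\<^sup>2)
     = (h_coeff (Suc n) 0)\<^sup>2 * y ^ (2 * n + 2) * r\<^sup>2"
    unfolding e1 e2[symmetric] by (simp add: power_mult_distrib mult_ac)
  ultimately have "(1 + y) ^ 2 * kernel_num n x y = 0"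
    unfolding kernel_num_def distrib_left by simp
  thus ?thesis using y1 by simp
qed

lemma linear_dvd:
  fixes p :: "'a::field poly"
  assumes "a \<noteq> 0" "poly p r = 0" "c + a * r = 0"
  shows "[:c, a:] dvd p"
proof -
  have *: "[:c, a:] = smult a [:- r, 1:]" using assms(3) by (simp add: eq_neg_iff_add_eq_0)
  show ?thesis unfolding * using assms(1,2) by (intro smult_dvd) (simp_all only: poly_eq_0_iff_dvd not_False_eq_True)
qed

lemma three_linear_dvd:
  fixes p :: "'a::field poly"
  assumes "a1 \<noteq> 0" "a2 \<noteq> 0" "a3 \<noteq> 0"
    and p: "poly p r1 = 0" "poly p r2 = 0" "poly p r3 = 0"
    and r: "c1 + a1 * r1 = 0" "c2 + a2 * r2 = 0" "c3 + a3 * r3 = 0"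
    and "r1 \<noteq> r2" "r1 \<noteq> r3" "r2 \<noteq> r3"
  shows "[:c1, a1:] * [:c2, a2:] * [:c3, a3:] dvd p"
proof -
  have ne: "poly [:c, a:] s \<noteq> 0" if "a \<noteq> 0" "c + a * r = 0" "r \<noteq> s" for a c r s :: 'a
  proof
    assume "poly [:c, a:] s = 0"
    hence "a * (r - s) = 0" using that(2) by (simp add: algebra_simps add_eq_0_iff)
    thus False using that by simp
  qed
  obtain p1 where p1: "p = [:c1, a1:] * p1" using linear_dvd[OF assms(1) p(1) r(1)] by (auto elim: dvdE)
  have z1: "poly p1 r2 = 0" "poly p1 r3 = 0"
    using p(2,3) ne[OF assms(1) r(1)] assms unfolding p1 poly_mult by auto
  obtain p2 where p2: "p1 = [:c2, a2:] * p2" using linear_dvd[OF assms(2) z1(1) r(2)] by (auto elim: dvdE)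
  have z2: "poly p2 r3 = 0"
    using z1(2) ne[OF assms(2) r(2)] assms unfolding p2 poly_mult by auto
  obtain p3 where p3: "p2 = [:c3, a3:] * p3" using linear_dvd[OF assms(3) z2 r(3)] by (auto elim: dvdE)
  have "p = [:c1, a1:] * [:c2, a2:] * [:c3, a3:] * p3" unfolding p1 p2 p3 by (simp only: mult.assoc)
  thus ?thesis by (rule dvdI)
qed

lemma poly_eqI_cofinite:
  fixes p r :: "'a::field_char_0 poly"
  assumes "finite S" "\<And>t. t \<notin> S \<Longrightarrow> poly p t = poly r t"
  shows "p = r"
proof (rule ccontr)
  assume "p \<noteq> r"
  hence "finite {t. poly (p - r) t = 0}" by (intro poly_roots_finite) simp
  moreover have "UNIV \<subseteq> S \<union> {t. poly (p - r) t = 0}" using assms(2) by auto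
  ultimately show False using assms(1) infinite_UNIV_char_0[where ?'a = 'a]
    by (meson finite_UnI finite_subset)
qed

text \<open>Replacing \<open>z\<close> by \<open>1 - z\<close> exchanges the two summands of the
  connection formula up to the sign \<open>(-1)^n\<close>.\<close>

lemma h_hom_reflect: "pcompose (h_hom n) [:1, -1:] = smult ((-1) ^ n) (h_hom n :: 'a::field_char_0 poly)"
proof -
  have 1: "pcompose ([:c, d:] ^ k) r = (pcompose [:c, d:] r) ^ k" for c d k and r :: "'a poly"
    by (induction k) (simp_all only: power_0 power_Suc pcompose_mult pcompose_1)
  have 2: "pcompose [:1, -1:] [:1, -1:] = [:0, 1 :: 'a:]" "pcompose [:0, 1:] [:1, -1:] = [:1, -1 :: 'a:]"
    by (simp_all add: pcompose_pCons)
  have 3: "pcompose (pcompose p [:1, -1:]) [:1, -1:] = p" for p :: "'a poly"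
    unfolding pcompose_assoc[symmetric] 2 by (simp add: pcompose_idR)
  show ?thesis
    unfolding h_poly_connection[of n, symmetric] pcompose_add pcompose_smult pcompose_mult 1 2 3
    by (simp add: smult_add_right flip: power_add)
qed

text \<open>Clears denominators in congruences modulo \<open>x^q\<close>: \<open>d\<close> is prime
  to \<open>x\<close>.\<close>

lemma monom_dvd_cancel:
  fixes d p :: "'a::field poly"
  assumes "poly d 0 \<noteq> 0" "monom 1 q dvd d * p"
  shows "monom 1 q dvd p"
proof (cases "p = 0")
  case False
  have d: "d \<noteq> 0" using assms(1) by auto
  have *: "monom 1 q = [:- 0, 1 :: 'a:] ^ q" by (simp add: monom_altdef)
  have "order 0 (d * p) = order 0 p"
    using d False order_root[of d 0] assms(1) by (simp add: order_mult)
  thus ?thesis using assms(2) d False unfolding * order_divides by simp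
qed simp

lemma degree_mult_bound:
  "degree p \<le> d \<Longrightarrow> degree r \<le> e \<Longrightarrow> d + e \<le> m \<Longrightarrow> degree (p * r) \<le> m"
  for p r :: "'a::comm_ring_1 poly"
  using degree_mult_le[of p r] by linarith

lemma degree_smult_bound: "degree p \<le> m \<Longrightarrow> degree (smult c p) \<le> m" for p :: "'a::comm_ring_1 poly"
  using degree_smult_le[of c p] by linarith

text \<open>The kernel of the inverse of \<open>\<Omega>\<close> is \<open>K(x, y) = - num / (b\<^sup>2 den)\<close>. In the locale \<open>y\<close> is a scalar
  and the polynomials are in \<open>x\<close>; \<open>N = n + 1\<close> and \<open>q = 2 N\<close>. The polynomials \<open>X\<close> and \<open>- T\<close>, \<open>S\<close> are what
  \<open>W\<close> and \<open>W, Ws\<close> become under the substitutions \<open>x \<mapsto> - 1 - x\<close> and (homogenised)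
  \<open>x \<mapsto> - x / (1 + x)\<close> that describe the actions of \<open>G R\<close> and \<open>R G\<close>.\<close>

locale kernel_at =
  fixes n :: nat and y :: "'a::field_char_0"
  assumes y0: "y \<noteq> 0" and y1: "1 + y \<noteq> 0" and y2: "y\<^sup>2 + y + 1 \<noteq> 0"
begin

abbreviation "q \<equiv> 2 * n + 2"
abbreviation "Z \<equiv> [:0, 1 :: 'a:]"
abbreviation "Z1 \<equiv> [:1, 1 :: 'a:]"
definition "b = (h_coeff (Suc n) 0 :: 'a)"
definition "s = ((-1) ^ n :: 'a)"
definition "uy = u_fun (Suc n) y"
definition "vy = v_fun (Suc n) y"
definition "uys = u_star (Suc n) y"
definition "vys = v_star (Suc n) y"
definition "Hp = pcompose (h_poly (Suc n)) Z1"
definition "Gp = pcompose (h_poly n) Z1"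
definition "Hm = pcompose (h_poly (Suc n)) [:0, -1 :: 'a:]"
definition "Gm = pcompose (h_poly n) [:0, -1 :: 'a:]"
text \<open>\<open>Us\<close> and \<open>Vs\<close> are polynomial forms of the starred
  \<open>u\<close> and \<open>v\<close>: by reciprocity the latter are values of \<open>h\<close> at
  \<open>x / (1 + x)\<close>, homogenised by powers of \<open>1 + x\<close>.\<close>

definition "Us = pcompose (h_hom (Suc n)) [:0, -1 :: 'a:]"
definition "Vs = Z * Z1 * pcompose (h_hom n) [:0, -1 :: 'a:]"
definition "W = smult vy (Z * Hp) - smult uy (Z1 * Gp)"
definition "Ws = smult vys Us - smult uys Vs"
definition "X = smult uy (Z * Gm) - smult vy (Z1 * Hm)"
definition "S = smult vys (Z1 * Hm) + smult uys (Z * Gm)"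
definition "T = smult vy (Z * Hp) + smult uy (Z1 * Gp)"
definition "num = smult (b\<^sup>2 * (1 + y) ^ q) (Z1 ^ q * [:y, -1:]\<^sup>2) + W * Ws"
definition "den = [:y, -1:] * [:1, 1 + y:] * [:1 + y, y:]"
text \<open>Both substitutions, the second one homogenised, carry \<open>den\<close> to
  \<open>D3\<close> up to sign. The factor \<open>1 - x y\<close> of \<open>D3\<close> is the
  denominator of the geometric series.\<close>

definition "D = [:1 + y, 1:] * [:y, 1 + y:]"
definition "D3 = D * [:1, -y:]"

lemma b0: "b \<noteq> 0" by (simp add: b_def h_coeff_0_nonzero)

lemma s_sq: "s * s = 1" unfolding s_def by (simp flip: power_mult_distrib)

lemma poly_W: "poly W t = W_fun (Suc n) t y"
  by (simp add: W_def W_fun_def uy_def vy_def u_fun_eq v_fun_eq Hp_def Gp_def poly_pcompose algebra_simps)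

lemma poly_Us: "t \<noteq> -1 \<Longrightarrow> poly Us t = (1 + t) ^ Suc n * poly (h_poly (Suc n)) (t / (1 + t))"
  and poly_Vs: "t \<noteq> -1 \<Longrightarrow> poly Vs t = t * (1 + t) ^ Suc n * poly (h_poly n) (t / (1 + t))"
  using poly_h_hom[of "- t" "Suc n"] poly_h_hom[of "- t" n]
  by (simp_all add: Us_def Vs_def poly_pcompose minus_equation_iff algebra_simps)

lemma star_eq:
  assumes "t \<noteq> 0" "t \<noteq> -1"
  shows "u_star (Suc n) t = (1 + t) ^ Suc n * poly (h_poly (Suc n)) (t / (1 + t))"
    and "v_star (Suc n) t = t * (1 + t) ^ Suc n * poly (h_poly n) (t / (1 + t))"
proof -
  have t1: "1 + t \<noteq> 0" using assms(2) by (auto simp: add_eq_0_iff)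
  have r: "t / (1 + t) \<noteq> 0" using assms t1 by simp
  have e: "1 / (t / (1 + t)) = 1 + 1 / t" using assms t1 by (simp add: field_simps)
  have *: "t ^ k * poly (h_poly k) (1 + 1 / t) = (1 + t) ^ k * poly (h_poly k) (t / (1 + t))" for k
  proof -
    have "(1 + t) ^ k * ((t / (1 + t)) ^ k * poly (h_poly k) (1 + 1 / t)) = t ^ k * poly (h_poly k) (1 + 1 / t)"
      using t1 by (simp add: power_divide)
    thus ?thesis using poly_h_poly_reciprocal[OF r, of k, unfolded e] by simp
  qed
  have "u_star (Suc n) t = t ^ Suc n * poly (h_poly (Suc n)) (1 + 1 / t)"
    using assms by (simp add: u_star_def u_fun_eq)
  thus "u_star (Suc n) t = (1 + t) ^ Suc n * poly (h_poly (Suc n)) (t / (1 + t))" by (simp only: *)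
  have "v_star (Suc n) t = t * (1 + t) * (t ^ n * poly (h_poly n) (1 + 1 / t))"
    using assms by (simp add: v_star_def v_fun_eq field_simps)
  thus "v_star (Suc n) t = t * (1 + t) ^ Suc n * poly (h_poly n) (t / (1 + t))"
    unfolding * by (simp add: mult_ac)
qed

lemma poly_Ws: "t \<noteq> 0 \<Longrightarrow> t \<noteq> -1 \<Longrightarrow> poly Ws t = W_star (Suc n) t y"
  unfolding Ws_def W_star_def star_eq[of t] vys_def[symmetric] uys_def[symmetric]
  by (simp add: poly_Us poly_Vs mult_ac)

lemma poly_num: "t \<noteq> 0 \<Longrightarrow> t \<noteq> -1 \<Longrightarrow> poly num t = kernel_num n t y"
proof -
  assume t: "t \<noteq> 0" "t \<noteq> -1"
  have 1: "poly Z1 t = 1 + t" "poly [:y, -1:] t = y - t" by simp_all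
  show ?thesis
    unfolding num_def kernel_num_def poly_add poly_mult poly_smult poly_power 1 poly_W poly_Ws[OF t]
      b_def power_mult_distrib
    by (simp only: mult_ac)
qed

lemma y_neq: "y \<noteq> -1" using y1 by (auto simp: add_eq_0_iff)

text \<open>Each coincidence would force \<open>y (1 + y) = -1\<close>, that is,
  \<open>y^2 + y + 1 = 0\<close>.\<close>

lemma roots_distinct:
  "y \<noteq> - 1 / (1 + y)" "y \<noteq> - (1 + y) / y" "- 1 / (1 + y) \<noteq> - (1 + y) / y"
  "-1 - y \<noteq> - y / (1 + y)" "-1 - y \<noteq> 1 / y" "- y / (1 + y) \<noteq> 1 / y"
proof -
  have c: False if "y * (1 + y) = -1" using that y2 by (simp add: power2_eq_square algebra_simps)
  show "y \<noteq> - 1 / (1 + y)" unfolding nonzero_eq_divide_eq[OF y1] using c by blast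
  have "y * (1 + y) = -1" if "y * y = - (1 + y)" using that by Groebner_Basis.algebra
  thus "y \<noteq> - (1 + y) / y" unfolding nonzero_eq_divide_eq[OF y0] using c by blast
  have "y * (1 + y) = -1" if "-1 * y = - (1 + y) * (1 + y)" using that by Groebner_Basis.algebra
  thus "- 1 / (1 + y) \<noteq> - (1 + y) / y" unfolding frac_eq_eq[OF y1 y0] using c by blast
  have "y * (1 + y) = -1" if "(-1 - y) * (1 + y) = - y" using that by Groebner_Basis.algebra
  thus "-1 - y \<noteq> - y / (1 + y)" unfolding nonzero_eq_divide_eq[OF y1] using c by blast
  have "y * (1 + y) = -1" if "(-1 - y) * y = 1" using that by Groebner_Basis.algebra
  thus "-1 - y \<noteq> 1 / y" unfolding nonzero_eq_divide_eq[OF y0] using c by blast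
  have "y * (1 + y) = -1" if "- y * y = 1 * (1 + y)" using that by Groebner_Basis.algebra
  thus "- y / (1 + y) \<noteq> 1 / y" unfolding frac_eq_eq[OF y1 y0] using c by blast
qed

text \<open>The roots of \<open>den\<close> are \<open>y\<close>, \<open>-1/(1+y)\<close> and
  \<open>-(1+y)/y\<close>. The first is covered by antisymmetry of \<open>W\<close>, the second by
  \<open>kernel_num_at\<close>, the third by the same lemma with the arguments swapped.\<close>

lemma den_dvd_num: "den dvd num"
  unfolding den_def
proof (rule three_linear_dvd)
  show "poly num y = 0"
    using y0 y_neq by (simp add: poly_num kernel_num_diag)
  have 1: "- 1 / (1 + y) * (1 + y) = - 1" using y1 by simp
  have "- 1 / (1 + y) \<noteq> 0" "- 1 / (1 + y) \<noteq> -1" using y0 y1 by (auto simp: field_simps)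
  from poly_num[OF this] show "poly num (- 1 / (1 + y)) = 0"
    by (rule trans) (rule kernel_num_at[OF 1 y0])
  have 2: "y * (1 + - (1 + y) / y) = -1" using y0 by (simp add: field_simps)
  have 3: "- (1 + y) / y \<noteq> 0"
    using y0 y1 by (simp only: divide_eq_0_iff neg_equal_0_iff_equal) simp
  moreover have "- (1 + y) / y \<noteq> -1" using y0 by (simp add: field_simps)
  ultimately have "poly num (- (1 + y) / y) = kernel_num n (- (1 + y) / y) y" by (rule poly_num)
  also have "\<dots> = 0" by (subst kernel_num_swap) (rule kernel_num_at[OF 2 3])
  finally show "poly num (- (1 + y) / y) = 0" .
qed (use y0 y1 roots_distinct in \<open>simp_all add: field_simps\<close>)

text \<open>The connection formulas at \<open>-x\<close> split \<open>Us\<close> and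
  \<open>Vs\<close> into a multiple of \<open>(1 + x)^q\<close> and a multiple of
  \<open>x^q\<close>, the two powers that govern the actions.\<close>

lemma connection1: "Z1 ^ q * Z1 * Hm + smult s (Z ^ q * Z * Hp) = Us"
  and connection2: "Z * Z1 ^ q * Gm - smult s (Z1 * Z ^ q * Gp) = Vs"
proof -
  have pw: "pcompose ([:c, d:] ^ k) r = (pcompose [:c, d:] r) ^ k" for c d k and r :: "'a poly"
    by (induction k) (simp_all only: power_0 power_Suc pcompose_mult pcompose_1)
  have 1: "pcompose [:1, -1:] [:0, -1:] = Z1" "pcompose [:0, 1:] [:0, -1:] = [:0, -1 :: 'a:]"
    by (simp_all add: pcompose_pCons)
  have 2: "pcompose (pcompose p [:1, -1:]) [:0, -1:] = pcompose p Z1" for p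
    unfolding pcompose_assoc[symmetric] 1 ..
  have neg: "[:0, -1 :: 'a:] ^ (2 * k + 1) = - (Z ^ (2 * k + 1))" for k
  proof -
    have *: "[:0, -1 :: 'a:] = - Z" by simp
    show ?thesis unfolding * by (rule power_minus_odd) simp
  qed
  have c: "pcompose (h_hom k) [:0, -1 :: 'a:] = Z1 ^ (2 * k + 1) * pcompose (h_poly k) [:0, -1 :: 'a:]
       - smult ((-1) ^ k) (Z ^ (2 * k + 1) * pcompose (h_poly k) Z1)" for k
    unfolding h_poly_connection[of k, symmetric] pcompose_add pcompose_smult pcompose_mult pw 1 2 neg
    by simp
  have p1: "r ^ (2 * Suc n + 1) = r ^ q * r" "r * r ^ (2 * n + 1) = r ^ q" for r :: "'a poly"
    by (simp_all add: mult_ac)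
  show "Z1 ^ q * Z1 * Hm + smult s (Z ^ q * Z * Hp) = Us"
    unfolding Us_def c p1 Hm_def Hp_def s_def by simp
  have "Vs = Z * (Z1 * Z1 ^ (2 * n + 1)) * Gm - smult s (Z1 * (Z * Z ^ (2 * n + 1)) * Gp)"
    unfolding Vs_def c Gm_def Gp_def s_def right_diff_distrib mult_smult_right by (simp only: mult_ac)
  thus "Z * Z1 ^ q * Gm - smult s (Z1 * Z ^ q * Gp) = Vs" unfolding p1 by simp
qed

lemma degree_Z_bounds: "degree Z \<le> 1" "degree Z1 \<le> 1" "degree (Z1 ^ m) \<le> m"
  by (simp_all add: degree_power_eq)

lemma degree_h_bounds:
  "degree Hp \<le> n + 1" "degree Gp \<le> n" "degree Hm \<le> n + 1" "degree Gm \<le> n"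
  "degree Us \<le> n + 1" "degree Vs \<le> n + 2"
proof -
  have "degree (pcompose (h_hom k) [:0, -1 :: 'a:]) \<le> k" for k
    using degree_h_hom_le[of k, where ?'a = 'a] by (simp add: degree_pcompose)
  from this[of "Suc n"] this[of n]
  show "degree Us \<le> n + 1" "degree Vs \<le> n + 2"
    unfolding Us_def Vs_def by (simp, intro degree_mult_bound[of _ 2 _ n] degree_mult_bound[of _ 1 _ 1] degree_Z_bounds) simp_all
qed (simp_all add: Hp_def Gp_def Hm_def Gm_def degree_pcompose degree_h_poly)

lemma degree_bounds:
  "degree W \<le> n + 2" "degree Ws \<le> n + 2" "degree X \<le> n + 2" "degree S \<le> n + 2" "degree T \<le> n + 2"
proof -
  have 1: "degree (Z * Hp) \<le> n + 2" "degree (Z1 * Hm) \<le> n + 2"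
    "degree (Z * Gm) \<le> n + 2" "degree (Z1 * Gp) \<le> n + 2"
    by (rule degree_mult_bound[OF degree_Z_bounds(1) degree_h_bounds(1)] degree_mult_bound[OF degree_Z_bounds(2) degree_h_bounds(3)]
       degree_mult_bound[OF degree_Z_bounds(1) degree_h_bounds(4)] degree_mult_bound[OF degree_Z_bounds(2) degree_h_bounds(2)]; simp)+
  have 2: "degree Us \<le> n + 2" using degree_h_bounds(5) by simp
  show "degree W \<le> n + 2" "degree Ws \<le> n + 2" "degree X \<le> n + 2" "degree S \<le> n + 2" "degree T \<le> n + 2"
    unfolding W_def Ws_def X_def S_def T_def
    by (intro degree_add_le degree_diff_le degree_smult_bound 1 2 degree_h_bounds(6))+
qed

lemma degree_num: "degree num \<le> 2 * n + 4"
  unfolding num_def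
  by (intro degree_add_le degree_smult_bound degree_mult_bound[OF degree_bounds(1,2)]
      degree_mult_bound[OF degree_Z_bounds(3), of _ 2]) (simp_all add: degree_power_eq)

lemma degree_den: "degree den = 3" and degree_D: "degree D = 2" and degree_D3: "degree D3 = 3"
  using y0 y1 y_neq y_neq[symmetric] by (simp_all add: den_def D_def D3_def degree_mult_eq)

text \<open>The substitution exchanges \<open>Z\<close> and \<open>Z1\<close> up to sign and turns
  \<open>Hp\<close>, \<open>Gp\<close> into \<open>Hm\<close>, \<open>Gm\<close>; \<open>Us\<close>
  and \<open>Vs\<close> only change sign, by \<open>h_hom_reflect\<close>.\<close>

lemma reflect:
  "pcompose W [:-1, -1:] = X" "pcompose Ws [:-1, -1:] = smult (- s) (smult vys Us + smult uys Vs)"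
proof -
  have 1: "pcompose Z [:-1, -1:] = - Z1" "pcompose Z1 [:-1, -1:] = - Z"
    "pcompose [:0, -1:] [:-1, -1:] = Z1" "pcompose [:1, -1:] [:0, -1:] = Z1"
    by (simp_all add: pcompose_pCons)
  have 2: "pcompose Hp [:-1, -1:] = Hm" "pcompose Gp [:-1, -1:] = Gm"
    unfolding Hp_def Gp_def Hm_def Gm_def pcompose_assoc[symmetric] 1 by simp_all
  have 3: "pcompose (pcompose (h_hom k) [:0, -1:]) [:-1, -1:] = smult ((-1) ^ k) (pcompose (h_hom k) [:0, -1 :: 'a:])" for k
    using arg_cong[OF h_hom_reflect[of k, where ?'a = 'a], of "\<lambda>p. pcompose p [:0, -1:]"]
    unfolding pcompose_assoc[symmetric] 1 pcompose_smult .
  show "pcompose W [:-1, -1:] = X"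
    unfolding W_def X_def pcompose_diff pcompose_smult pcompose_mult 1 2 mult_minus_left smult_minus_right
    by (simp only: diff_minus_eq_add uminus_add_conv_diff)
  have 4: "pcompose Us [:-1, -1:] = smult (- s) Us" "pcompose Vs [:-1, -1:] = smult s Vs"
    unfolding Us_def Vs_def pcompose_mult 3 1 by (simp_all add: s_def mult_ac)
  show "pcompose Ws [:-1, -1:] = smult (- s) (smult vys Us + smult uys Vs)"
    unfolding Ws_def pcompose_diff pcompose_smult 4 by (simp add: smult_add_right mult_ac)
qed

lemma poly_X: "poly X t = W_fun (Suc n) (- 1 - t) y"
  unfolding reflect(1)[symmetric] poly_pcompose poly_W by simp

text \<open>With \<open>r = -t / (1 + t)\<close> one has \<open>1 + r = 1 / (1 + t)\<close> and
  \<open>r / (1 + r) = -t\<close>. Hence \<open>Us\<close>, \<open>Vs\<close> lead to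
  \<open>Hm\<close>, \<open>Gm\<close>, while reciprocity brings \<open>Hp\<close>,
  \<open>Gp\<close> back to themselves.\<close>

lemma poly_S_T:
  assumes "1 + t \<noteq> 0"
  shows "poly S t = (1 + t) ^ (n + 2) * poly Ws (- t / (1 + t))"
    and "poly T t = - ((1 + t) ^ (n + 2) * poly W (- t / (1 + t)))"
proof -
  define w where "w = 1 + t"
  have w: "w \<noteq> 0" using assms by (simp add: w_def)
  define r where "r = - t / w"
  have r: "1 + r = 1 / w" "r / (1 + r) = - t"
    using w unfolding r_def by (simp_all add: field_simps) (simp_all add: w_def)
  have r1: "r \<noteq> -1" using r(1) w by auto
  have wr: "w * r = - t" using w by (simp add: r_def)
  have inv: "w ^ k * (1 / w) ^ k = 1" for k using w by (simp add: power_divide)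
  have ww: "w ^ (n + 2) = w * w ^ Suc n" "w ^ (n + 2) = w * (w * w ^ n)" by simp_all
  have pz: "poly Z1 r = 1 / w" "poly Z1 t = w" using r(1) by (simp_all add: w_def)
  have U: "w ^ (n + 2) * poly Us r = w * poly Hm t"
  proof -
    have "w ^ (n + 2) * poly Us r = w * (w ^ Suc n * (1 / w) ^ Suc n) * poly (h_poly (Suc n)) (- t)"
      unfolding poly_Us[OF r1] r(2) unfolding r(1) ww(1) by (simp only: mult_ac)
    thus ?thesis unfolding inv by (simp add: Hm_def poly_pcompose)
  qed
  have V: "w ^ (n + 2) * poly Vs r = - t * poly Gm t"
  proof -
    have "w ^ (n + 2) * poly Vs r = (w * r) * (w ^ Suc n * (1 / w) ^ Suc n) * poly (h_poly n) (- t)"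
      unfolding poly_Vs[OF r1] r(2) unfolding r(1) ww(1) by (simp only: mult_ac)
    thus ?thesis unfolding inv wr by (simp add: Gm_def poly_pcompose)
  qed
  have rec: "w ^ k * poly (h_poly k) (1 / w) = poly (h_poly k) w" for k
    using poly_h_poly_reciprocal[OF w] .
  have H: "w ^ (n + 2) * (r * poly Hp r) = - t * poly Hp t"
  proof -
    have "w ^ (n + 2) * (r * poly Hp r) = (w * r) * (w ^ Suc n * poly (h_poly (Suc n)) (1 / w))"
      unfolding Hp_def poly_pcompose pz ww(1) by (simp only: mult_ac)
    thus ?thesis unfolding rec wr Hp_def poly_pcompose pz .
  qed
  have G: "w ^ (n + 2) * ((1 + r) * poly Gp r) = w * poly Gp t"
  proof -
    have "w ^ (n + 2) * ((1 + r) * poly Gp r) = w * (w * (1 / w)) * (w ^ n * poly (h_poly n) (1 / w))"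
      unfolding Gp_def poly_pcompose pz r(1) ww(2) by (simp only: mult_ac)
    thus ?thesis unfolding rec using w by (simp add: Gp_def poly_pcompose pz(2) del: poly_pCons)
  qed
  have "w ^ (n + 2) * poly Ws r = vys * (w ^ (n + 2) * poly Us r) - uys * (w ^ (n + 2) * poly Vs r)"
    by (simp add: Ws_def algebra_simps)
  also have "\<dots> = poly S t" unfolding U V by (simp add: S_def w_def algebra_simps)
  finally show "poly S t = (1 + t) ^ (n + 2) * poly Ws (- t / (1 + t))" by (simp add: w_def r_def)
  have "w ^ (n + 2) * poly W r = vy * (w ^ (n + 2) * (r * poly Hp r)) - uy * (w ^ (n + 2) * ((1 + r) * poly Gp r))"
    by (simp add: W_def algebra_simps)
  also have "\<dots> = - poly T t" unfolding H G by (simp add: T_def w_def algebra_simps)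
  finally show "poly T t = - ((1 + t) ^ (n + 2) * poly W (- t / (1 + t)))" by (simp add: w_def r_def)
qed

text \<open>At \<open>-1 - y\<close> and \<open>-y / (1 + y)\<close> both terms vanish:
  \<open>X\<close> or \<open>S\<close> by antisymmetry, \<open>D\<close> by one of its factors. At
  \<open>t = 1 / y\<close> both terms equal \<open>t^2 (y^2 + y + 1)^2\<close>, by
  \<open>W_fun_at\<close> and \<open>W_star_at\<close>.\<close>

lemma D3_dvd: "D3 dvd smult (s / b\<^sup>2) (X * S) - D"
  unfolding D3_def D_def
proof (rule three_linear_dvd)
  have X0: "poly X (-1 - y) = 0" by (simp add: poly_X W_fun_def)
  show "poly (smult (s / b\<^sup>2) (X * S) - [:1 + y, 1:] * [:y, 1 + y:]) (-1 - y) = 0"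
  proof -
    have "poly [:1 + y, 1:] (-1 - y) = 0" by simp
    thus ?thesis by (simp only: poly_diff poly_smult poly_mult X0 mult_zero_left mult_zero_right diff_self)
  qed
  have 1: "1 + - y / (1 + y) = 1 / (1 + y)" using y1 by (simp add: field_simps)
  have S0: "poly S (- y / (1 + y)) = 0"
  proof -
    have "poly S (- y / (1 + y)) = (1 / (1 + y)) ^ (n + 2) * poly Ws (- (- y / (1 + y)) / (1 / (1 + y)))"
      using poly_S_T(1)[of "- y / (1 + y)"] y1 unfolding 1 by simp
    also have "- (- y / (1 + y)) / (1 / (1 + y)) = y" using y1 by simp
    finally show ?thesis using y0 y_neq by (simp add: poly_Ws W_star_def)
  qed
  show "poly (smult (s / b\<^sup>2) (X * S) - [:1 + y, 1:] * [:y, 1 + y:]) (- y / (1 + y)) = 0"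
  proof -
    have "poly [:y, 1 + y:] (- y / (1 + y)) = 0" using y1 by simp
    thus ?thesis by (simp only: poly_diff poly_smult poly_mult S0 mult_zero_left mult_zero_right diff_self)
  qed
  define t where "t = 1 / y"
  define p where "p = y\<^sup>2 + y + 1"
  have ty: "t * y = 1" using y0 by (simp add: t_def)
  have X1: "poly X t = b * (- t) ^ n * (t\<^sup>2 * p)"
  proof -
    have "y * (1 + (-1 - t)) = -1" using ty by (simp add: mult.commute)
    from W_fun_at[OF this, of n]
    have "poly X t = b * (- t) ^ n * ((-1 - t)\<^sup>2 + (-1 - t) + 1)"
      unfolding poly_X by (subst W_fun_swap) (simp add: b_def)
    also have "(-1 - t)\<^sup>2 + (-1 - t) + 1 = t\<^sup>2 * p" unfolding p_def using ty by Groebner_Basis.algebra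
    finally show ?thesis .
  qed
  have S1: "poly S t = b * y ^ n * p"
  proof -
    have e: "1 + t = t * (1 + y)" using ty by (simp add: algebra_simps)
    have t1: "1 + t \<noteq> 0" unfolding e using y0 y1 by (simp add: t_def)
    have r: "- t / (1 + t) = - 1 / (1 + y)" unfolding e using y0 y1 by (simp add: t_def)
    have "- 1 / (1 + y) \<noteq> 0" "- 1 / (1 + y) \<noteq> -1" using y0 y1 by (auto simp: field_simps)
    note w = poly_Ws[OF this]
    have 2: "- 1 / (1 + y) * (1 + y) = - 1" using y1 by simp
    have "poly S t = t ^ (n + 2) * ((1 + y) ^ (n + 2) * W_star (Suc n) (- 1 / (1 + y)) y)"
      unfolding poly_S_T(1)[OF t1] r w unfolding e power_mult_distrib by (simp only: mult.assoc)
    also have "\<dots> = (t * y) ^ (n + 2) * (b * y ^ n * p)"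
    proof -
      have "y ^ (2 * n + 2) = y ^ (n + 2) * y ^ n"
        unfolding power_add[symmetric] by (rule arg_cong[where f = "power y"]) simp
      thus ?thesis
        unfolding W_star_at[OF 2 y0] b_def[symmetric] p_def[symmetric] power_mult_distrib
        by (simp only: mult_ac)
    qed
    finally show ?thesis unfolding ty by simp
  qed
  have "s / b\<^sup>2 * (poly X t * poly S t) = t\<^sup>2 * p * p"
  proof -
    have "(- t) ^ n * y ^ n = s" unfolding s_def power_mult_distrib[symmetric] using ty by simp
    hence "poly X t * poly S t = s * b\<^sup>2 * (t\<^sup>2 * p * p)"
      unfolding X1 S1 by (simp add: power2_eq_square mult_ac)
    thus ?thesis using b0 s_sq by (simp add: field_simps)
  qed
  moreover have "poly ([:1 + y, 1:] * [:y, 1 + y:]) t = t\<^sup>2 * p * p"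
  proof -
    have "(1 + y + t) * (y + t * (1 + y)) = t\<^sup>2 * p * p" unfolding p_def using ty by Groebner_Basis.algebra
    thus ?thesis unfolding poly_mult by simp
  qed
  ultimately show "poly (smult (s / b\<^sup>2) (X * S) - [:1 + y, 1:] * [:y, 1 + y:]) (1 / y) = 0"
    unfolding t_def[symmetric] poly_diff poly_smult poly_mult by simp
qed (use y0 y1 roots_distinct in \<open>simp_all add: field_simps\<close>)

section \<open>The kernel as a polynomial in x and its two images\<close>

lemma geometric_poly: "[:1, -y:] * (\<Sum>i<m. monom (y ^ i) i) = 1 - monom (y ^ m) m"
proof (induction m)
  case (Suc m)
  have "[:1, -y:] * monom (y ^ m) m = monom (y ^ m) m - monom (y ^ Suc m) (Suc m)"
    by (simp add: smult_monom monom_Suc mult.commute minus_monom)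
  thus ?case unfolding sum.lessThan_Suc distrib_left Suc by simp
qed simp

text \<open>\<open>k\<close> is the kernel \<open>K(_, y)\<close>, \<open>g0\<close> its image under \<open>R G\<close>, and \<open>g0 + (\<Sum>i<q. (x y)\<^sup>i)\<close> its image
  under \<open>G R\<close>.\<close>

definition "k = smult (- 1 / b\<^sup>2) (num div den)"
definition "g0 = (smult (s / b\<^sup>2) (X * S) - D) div D3"
text \<open>This is \<open>(1 + x)^(q-1) k(-x / (1 + x))\<close>, the sum in the hypothesis of
  \<open>GR_entry_transpose_action\<close>.\<close>

definition "kt = (\<Sum>j<q. smult (coeff k j) ([:0, -1:] ^ j * Z1 ^ (q - 1 - j)))"

lemma den_k: "smult (b\<^sup>2) (den * k) = - num"
  using den_dvd_num b0 by (simp add: k_def)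

lemma D3_g0: "smult (b\<^sup>2) (D3 * g0) = smult s (X * S) - smult (b\<^sup>2) D"
  using D3_dvd b0 by (simp add: g0_def smult_diff_right)

lemma degree_k: "degree k < q"
proof (cases "k = 0")
  case False
  have "den \<noteq> 0" using degree_den by auto
  hence "degree (den * k) = 3 + degree k" using False by (simp add: degree_mult_eq degree_den)
  moreover have "degree (den * k) = degree num"
    using arg_cong[OF den_k, of degree] b0 by simp
  ultimately show ?thesis using degree_num by simp
qed simp

lemma pcompose_k:
  "smult (b\<^sup>2) (D3 * pcompose k [:-1, -1:])
     = smult (b\<^sup>2 * (1 + y) ^ q) (monom 1 q * [:1 + y, 1:]\<^sup>2) + X * pcompose Ws [:-1, -1:]"
proof -
  have pw: "pcompose (p ^ m) r = (pcompose p r) ^ m" for p r :: "'a poly" and m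
    by (induction m) (simp_all only: power_0 power_Suc pcompose_mult pcompose_1)
  have c: "pcompose [:y, -1:] [:-1, -1:] = [:1 + y, 1:]" "pcompose [:1, 1 + y:] [:-1, -1:] = - [:y, 1 + y:]"
    "pcompose [:1 + y, y:] [:-1, -1:] = [:1, - y:]" "pcompose Z1 [:-1, -1:] = - Z"
    by (simp_all add: pcompose_pCons)
  have M: "(- Z) ^ q = monom 1 q"
    using power_minus_even[of q Z] by (simp add: monom_altdef)
  have d: "pcompose den [:-1, -1:] = - D3"
    unfolding den_def pcompose_mult c D3_def D_def by (simp only: mult_minus_left mult_minus_right)
  have "smult (b\<^sup>2) (pcompose den [:-1, -1:] * pcompose k [:-1, -1:]) = - pcompose num [:-1, -1:]"
    using arg_cong[OF den_k, of "\<lambda>p. pcompose p [:-1, -1:]"]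
    unfolding pcompose_smult pcompose_mult pcompose_uminus .
  hence "smult (b\<^sup>2) (D3 * pcompose k [:-1, -1:]) = pcompose num [:-1, -1:]"
    unfolding d by (simp only: mult_minus_left smult_minus_right neg_equal_iff_equal)
  also have "\<dots> = smult (b\<^sup>2 * (1 + y) ^ q) (monom 1 q * [:1 + y, 1:]\<^sup>2) + X * pcompose Ws [:-1, -1:]"
    unfolding num_def pcompose_add pcompose_smult pcompose_mult pw c M reflect(1) ..
  finally show ?thesis .
qed

lemma poly_kt: "1 + t \<noteq> 0 \<Longrightarrow> poly kt t = (1 + t) ^ (q - 1) * poly k (- t / (1 + t))"
proof -
  assume t: "1 + t \<noteq> 0"
  have "k = (\<Sum>j<q. monom (coeff k j) j)"
    by (rule poly_eqI) (use degree_k in \<open>auto simp: coeff_sum intro: coeff_eq_0\<close>)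
  from arg_cong[OF this, of "\<lambda>p. poly p (- t / (1 + t))"]
  have pk: "poly k (- t / (1 + t)) = (\<Sum>j<q. coeff k j * (- t / (1 + t)) ^ j)"
    unfolding poly_sum poly_monom .
  have "(1 + t) ^ (q - 1) * poly k (- t / (1 + t)) =
      (\<Sum>j<q. coeff k j * ((- t) ^ j * (1 + t) ^ (q - 1 - j)))"
    unfolding pk sum_distrib_left power_divide
  proof (intro sum.cong refl)
    fix j assume "j \<in> {..<q}"
    hence "j \<le> q - 1" by auto
    hence "(1 + t) ^ (q - 1) = (1 + t) ^ j * (1 + t) ^ (q - 1 - j)" by (simp flip: power_add)
    thus "(1 + t) ^ (q - 1) * (coeff k j * ((- t) ^ j / (1 + t) ^ j)) = coeff k j * ((- t) ^ j * (1 + t) ^ (q - 1 - j))"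
      using t by (simp del: add_2_eq_Suc')
  qed
  also have "\<dots> = poly kt t"
    unfolding kt_def poly_sum poly_smult poly_mult poly_power by simp
  finally show ?thesis ..
qed

text \<open>The identity \<open>den_k\<close> at \<open>-t / (1 + t)\<close>, multiplied by
  \<open>(1 + t)^(q+2)\<close>: three factors homogenise \<open>den\<close>, the other
  \<open>q - 1\<close> homogenise \<open>k\<close>. Agreement at all \<open>t\<close> except
  \<open>-1\<close> suffices.\<close>

lemma D3_kt: "smult (b\<^sup>2) (D3 * kt) = T * S - smult (b\<^sup>2 * (1 + y) ^ q) ([:y, 1 + y:]\<^sup>2)"
proof (rule poly_eqI_cofinite[of "{-1}"])
  fix t :: 'a assume "t \<notin> {-1}"
  hence t: "1 + t \<noteq> 0" by (auto simp: add_eq_0_iff)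
  define w where "w = 1 + t"
  have w: "w \<noteq> 0" using t by (simp add: w_def)
  define r where "r = - t / w"
  have wr: "w * r = - t" using w by (simp add: r_def)
  have w1: "w * (1 + r) = 1" using wr by (simp add: w_def algebra_simps)
  have den: "w ^ 3 * poly den r = poly D3 t"
  proof -
    have "w ^ 3 * poly den r = (w * (y - r)) * (w * (1 + r * (1 + y))) * (w * (1 + y + r * y))"
    proof -
      have "poly [:y, -1:] r = y - r" "poly [:1, 1 + y:] r = 1 + r * (1 + y)" "poly [:1 + y, y:] r = 1 + y + r * y"
        by simp_all
      thus ?thesis unfolding den_def poly_mult power3_eq_cube by (simp only: mult_ac)
    qed
    also have "w * (y - r) = y + t * (1 + y)" using wr w_def by Groebner_Basis.algebra
    also have "w * (1 + r * (1 + y)) = 1 - t * y" using wr w_def by Groebner_Basis.algebra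
    also have "w * (1 + y + r * y) = 1 + y + t" using wr w_def by Groebner_Basis.algebra
    finally show ?thesis unfolding D3_def D_def poly_mult by simp
  qed
  have num: "w ^ (q + 2) * poly num r = b\<^sup>2 * (1 + y) ^ q * (y + t * (1 + y))\<^sup>2 - poly T t * poly S t"
  proof -
    have 1: "w * (y - r) = y + t * (1 + y)" using wr w_def by Groebner_Basis.algebra
    have 2: "poly Z1 r = 1 + r" "poly [:y, -1:] r = y - r" by simp_all
    have e: "q + 2 = (n + 2) + (n + 2)" by simp
    have "w ^ (q + 2) * poly num r = b\<^sup>2 * (1 + y) ^ q * ((w * (1 + r)) ^ q * (w * (y - r))\<^sup>2)
        + w ^ (q + 2) * (poly W r * poly Ws r)"
      unfolding num_def poly_add poly_smult poly_mult poly_power 2 power_mult_distrib distrib_left[of "w ^ (q + 2)"]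
      unfolding power_add[of w q 2]
      by (simp only: mult_ac)
    also have "w ^ (q + 2) * (poly W r * poly Ws r) = (w ^ (n + 2) * poly W r) * (w ^ (n + 2) * poly Ws r)"
      unfolding e power_add[of w "n + 2" "n + 2"] by (simp only: mult_ac)
    also have "\<dots> = - (poly T t * poly S t)"
      using poly_S_T[OF t] unfolding w_def r_def by simp
    finally show ?thesis unfolding w1 1 by simp
  qed
  have k: "b\<^sup>2 * (poly den r * poly k r) = - poly num r"
    using arg_cong[OF den_k, of "\<lambda>p. poly p r"] by simp
  have e: "w ^ (q + 2) = w ^ 3 * w ^ (q - 1)" unfolding power_add[symmetric] by (rule arg_cong[where f = "power w"]) simp
  have "poly (smult (b\<^sup>2) (D3 * kt)) t = b\<^sup>2 * (w ^ 3 * poly den r * (w ^ (q - 1) * poly k r))"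
    unfolding den poly_smult poly_mult poly_kt[OF t] by (simp only: w_def r_def)
  also have "\<dots> = w ^ (q + 2) * (b\<^sup>2 * (poly den r * poly k r))"
    unfolding e by (simp only: mult_ac)
  also have "\<dots> = - (w ^ (q + 2) * poly num r)" unfolding k by simp
  also have "\<dots> = poly (T * S - smult (b\<^sup>2 * (1 + y) ^ q) ([:y, 1 + y:]\<^sup>2)) t"
    unfolding num poly_diff poly_smult poly_mult poly_power by simp
  finally show "poly (smult (b\<^sup>2) (D3 * kt)) t = poly (T * S - smult (b\<^sup>2 * (1 + y) ^ q) ([:y, 1 + y:]\<^sup>2)) t" .
qed simp

text \<open>After clearing \<open>b^2\<close> and \<open>D3\<close>, the multiples of
  \<open>(1 + x)^q\<close> coming from \<open>g0\<close> and from the reflected \<open>Ws\<close>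
  cancel by the connection formulas, and the \<open>D\<close> in \<open>g0\<close> cancels against
  the geometric series. The rest is a multiple of \<open>x^q\<close>, as
  \<open>GR_entry_action\<close> requires.\<close>

lemma GR_entry_k:
  assumes "i < q"
  shows "(\<Sum>j<q. GR_entry q i j * coeff k j) = coeff g0 i + y ^ i"
proof -
  define Y where "Y = (\<Sum>i<q. monom (y ^ i) i)"
  define M where "M = monom (1 :: 'a) q"
  define B c s' v' u' yq where "B = [:b\<^sup>2:]" and "c = [:b\<^sup>2 * (1 + y) ^ q:]" and "s' = [:s:]"
    and "v' = [:vys:]" and "u' = [:uys:]" and "yq = [:y ^ q:]"
  have sm: "smult a p = [:a:] * p" for a and p :: "'a poly" by simp
  have "monom 1 q dvd Z1 ^ q * (g0 + Y) + pcompose k [:-1, -1:]"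
  proof (rule monom_dvd_cancel)
    show "poly (smult (b\<^sup>2) D3) 0 \<noteq> 0" using y0 y1 b0 by (simp add: D3_def D_def)
    have 1: "B * (D3 * g0) = s' * (X * S) - B * D" using D3_g0 unfolding sm B_def s'_def .
    have 2: "[:1, -y:] * Y = 1 - yq * M"
      unfolding Y_def geometric_poly yq_def M_def by (simp add: smult_monom)
    have 3: "D3 = D * [:1, -y:]" by (simp add: D3_def)
    have 4: "B * (D3 * pcompose k [:-1, -1:]) = c * (M * [:1 + y, 1:]\<^sup>2) + X * pcompose Ws [:-1, -1:]"
      using pcompose_k unfolding sm B_def c_def M_def .
    have 5: "pcompose Ws [:-1, -1:] = - s' * (v' * Us + u' * Vs)"
      unfolding reflect(2) s'_def v'_def u'_def by simp
    have M: "Z ^ q = M" unfolding M_def by (simp add: monom_altdef del: power_Suc add_2_eq_Suc')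
    have 6: "Z1 ^ q * Z1 * Hm + s' * (M * Z * Hp) = Us" "Z * Z1 ^ q * Gm - s' * (Z1 * M * Gp) = Vs"
      using connection1 connection2 unfolding sm s'_def M .
    have 7: "S = v' * (Z1 * Hm) + u' * (Z * Gm)"
      unfolding S_def v'_def u'_def sm ..
    have 8: "s' * s' = 1" using s_sq by (simp add: s'_def one_pCons)
    have alg: "B * D3' * (E * (g0' + Y') + kr) = M' * (c' * P\<^sup>2 - B * D' * yq' * E - X' * (vv * Zz * Hp' - uu * Zo * Gp'))"
      if "B * (D3' * g0') = ss * (X' * S') - B * D'" "L * Y' = 1 - yq' * M'" "D3' = D' * L"
        "B * (D3' * kr) = c' * (M' * P\<^sup>2) + X' * wr" "wr = - ss * (vv * U + uu * V)"
        "E * Zo * Hm' + ss * (M' * Zz * Hp') = U" "Zz * E * Gm' - ss * (Zo * M' * Gp') = V"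
        "S' = vv * (Zo * Hm') + uu * (Zz * Gm')" "ss * ss = 1"
      for B D3' g0' ss X' S' D' L Y' yq' M' kr c' P wr vv U uu V E Zo Hm' Zz Hp' Gm' Gp' :: "'a poly"
    proof -
      have "B * D3' * (E * (g0' + Y') + kr) = E * (B * (D3' * g0')) + B * E * D' * (L * Y') + B * (D3' * kr)"
        unfolding that(3) by (simp add: algebra_simps)
      also have "\<dots> = X' * (ss * E * S' + wr) - B * E * D' * yq' * M' + c' * (M' * P\<^sup>2)"
        unfolding that(1,2,4) by (simp add: algebra_simps)
      also have "ss * E * S' + wr = - M' * (vv * Zz * Hp' - uu * Zo * Gp')"
        unfolding that(5,8) that(6,7)[symmetric] using that(9) by Groebner_Basis.algebra
      finally show ?thesis by (simp add: algebra_simps)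
    qed
    have "monom 1 q dvd B * D3 * (Z1 ^ q * (g0 + Y) + pcompose k [:-1, -1:])"
      unfolding alg[OF 1 2 3 4 5 6 7 8] M_def by (rule dvd_triv_left)
    thus "monom 1 q dvd smult (b\<^sup>2) D3 * (Z1 ^ q * (g0 + Y) + pcompose k [:-1, -1:])"
      unfolding sm B_def .
  qed
  moreover have "coeff (\<Sum>i<m. monom (y ^ i) i) i = (if i < m then y ^ i else 0)" for m
    by (simp add: coeff_sum)
  hence "coeff Y i = y ^ i" unfolding Y_def using assms by (simp only: if_True)
  ultimately show ?thesis using GR_entry_action[OF degree_k _ assms, of "g0 + Y"] by simp
qed

text \<open>\<open>P\<close> has to have degree below \<open>q\<close> for
  \<open>GR_entry_transpose_action\<close>. In \<open>D3 * P\<close> the connection formulas merge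
  the high-degree terms into \<open>S\<close> times \<open>smult vy Us - smult uy Vs\<close>, both
  of degree at most \<open>n + 2\<close>. This gives the bound \<open>q + 2\<close>, of which
  \<open>D3\<close> accounts for 3.\<close>

lemma GR_entry_transpose_k:
  assumes "i < q"
  shows "(\<Sum>j<q. GR_entry q j i * coeff k j) = coeff g0 i"
proof -
  define M where "M = monom (1 :: 'a) q"
  define P where "P = Z1 ^ q * g0 - M * kt"
  define B c s' v' u' where "B = [:b\<^sup>2:]" and "c = [:b\<^sup>2 * (1 + y) ^ q:]" and "s' = [:s:]"
    and "v' = [:vy:]" and "u' = [:uy:]"
  have sm: "smult a p = [:a:] * p" for a and p :: "'a poly" by simp
  have 1: "B * (D3 * g0) = s' * (X * S) - B * D" using D3_g0 unfolding sm B_def s'_def .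
  have 2: "B * (D3 * kt) = T * S - c * [:y, 1 + y:]\<^sup>2" using D3_kt unfolding sm B_def c_def .
  have M: "Z ^ q = M" unfolding M_def by (simp add: monom_altdef del: power_Suc add_2_eq_Suc')
  have 3: "Z1 ^ q * Z1 * Hm + s' * (M * Z * Hp) = Us" "Z * Z1 ^ q * Gm - s' * (Z1 * M * Gp) = Vs"
    using connection1 connection2 unfolding sm s'_def M .
  have 4: "X = u' * (Z * Gm) - v' * (Z1 * Hm)" "T = v' * (Z * Hp) + u' * (Z1 * Gp)"
    unfolding X_def T_def v'_def u'_def sm by simp_all
  have 5: "s' * s' = 1" using s_sq by (simp add: s'_def one_pCons)
  have alg: "B * (D3' * (E * g0' - M' * kt')) = c' * (M' * p\<^sup>2) - B * (E * D') - ss * S' * (vv * U - uu * V)"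
    if "B * (D3' * g0') = ss * (X' * S') - B * D'" "B * (D3' * kt') = T' * S' - c' * p\<^sup>2"
      "E * Zo * Hm' + ss * (M' * Zz * Hp') = U" "Zz * E * Gm' - ss * (Zo * M' * Gp') = V"
      "X' = uu * (Zz * Gm') - vv * (Zo * Hm')" "T' = vv * (Zz * Hp') + uu * (Zo * Gp')" "ss * ss = 1"
    for B D3' g0' ss X' S' D' M' kt' c' p T' vv U uu V E Zo Hm' Zz Hp' Gm' Gp' :: "'a poly"
  proof -
    have "B * (D3' * (E * g0' - M' * kt')) = E * (B * (D3' * g0')) - M' * (B * (D3' * kt'))"
      by (simp add: algebra_simps)
    also have "\<dots> = c' * (M' * p\<^sup>2) - B * (E * D') + S' * (ss * E * X' - M' * T')"
      unfolding that(1,2) by (simp add: algebra_simps)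
    also have "ss * E * X' - M' * T' = - ss * (vv * U - uu * V)"
      unfolding that(5,6) that(3,4)[symmetric] using that(7) by Groebner_Basis.algebra
    finally show ?thesis by (simp add: algebra_simps)
  qed
  have eq: "smult (b\<^sup>2) (D3 * P) = smult (b\<^sup>2 * (1 + y) ^ q) (M * [:y, 1 + y:]\<^sup>2) - smult (b\<^sup>2) (Z1 ^ q * D)
     - smult s (S * (smult vy Us - smult uy Vs))"
    using alg[OF 1 2 3 4 5] unfolding P_def sm B_def c_def s'_def v'_def u'_def by (simp only: mult.assoc)
  have "degree (smult (b\<^sup>2) (D3 * P)) \<le> q + 2"
    unfolding eq
  proof (intro degree_diff_le degree_smult_bound)
    show "degree (M * [:y, 1 + y:]\<^sup>2) \<le> q + 2"
      by (rule degree_mult_bound[of _ q _ 2]) (simp_all add: M_def degree_monom_le degree_power_le[THEN order.trans])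
    show "degree (Z1 ^ q * D) \<le> q + 2"
      by (rule degree_mult_bound[OF degree_Z_bounds(3), of _ 2]) (simp_all add: degree_D)
    have "degree (smult vy Us - smult uy Vs) \<le> n + 2"
      using degree_h_bounds by (intro degree_diff_le degree_smult_bound) simp_all
    thus "degree (S * (smult vy Us - smult uy Vs)) \<le> q + 2"
      by (rule degree_mult_bound[OF degree_bounds(4)]) simp
  qed
  hence deg: "degree (D3 * P) \<le> q + 2" using b0 by simp
  have "degree P < q"
  proof (cases "P = 0")
    case False
    moreover have "D3 \<noteq> 0" using degree_D3 by auto
    ultimately show ?thesis using deg by (simp add: degree_mult_eq degree_D3)
  qed simp
  hence "degree (Z1 ^ q * g0 - monom 1 q * (\<Sum>j<q. smult (coeff k j) ([:0, -1:] ^ j * Z1 ^ (q - 1 - j)))) < q"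
    unfolding P_def M_def kt_def .
  from GR_entry_transpose_action[OF _ assms this] show ?thesis by simp
qed

end

text \<open>Frees the results from the constants of the locale, over any field of characteristic
  zero, so that \<open>y\<close> can be an indeterminate.\<close>

lemma kernel_solution:
  fixes y :: "'a::field_char_0"
  assumes "y \<noteq> 0" "1 + y \<noteq> 0" "y\<^sup>2 + y + 1 \<noteq> 0"
  shows "\<exists>k :: 'a poly. degree k < 2 * n + 2
    \<and> (\<forall>x. x \<noteq> 0 \<longrightarrow> x \<noteq> -1 \<longrightarrow>
        (h_coeff (Suc n) 0)\<^sup>2 * ((y - x) * (1 + x + x * y) * (1 + y + x * y)) * poly k x = - kernel_num n x y)
    \<and> (\<forall>i<2 * n + 2.
        (\<Sum>j<2 * n + 2. (GR_entry (2 * n + 2) i j - GR_entry (2 * n + 2) j i) * coeff k j) = y ^ i)"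
proof -
  interpret kernel_at n y using assms by unfold_locales
  show ?thesis
  proof (intro exI[of _ k] conjI allI impI)
    show "degree k < 2 * n + 2" by (rule degree_k)
    fix x :: 'a assume x: "x \<noteq> 0" "x \<noteq> -1"
    have "poly den x = (y - x) * (1 + x + x * y) * (1 + y + x * y)"
      unfolding den_def poly_mult by (simp add: algebra_simps)
    thus "(h_coeff (Suc n) 0)\<^sup>2 * ((y - x) * (1 + x + x * y) * (1 + y + x * y)) * poly k x = - kernel_num n x y"
      using arg_cong[OF den_k, of "\<lambda>p. poly p x"] by (simp add: poly_num[OF x] b_def mult.assoc)
  next
    fix i assume "i < 2 * n + 2"
    thus "(\<Sum>j<2 * n + 2. (GR_entry (2 * n + 2) i j - GR_entry (2 * n + 2) j i) * coeff k j) = y ^ i"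
      using GR_entry_k[of i] GR_entry_transpose_k[of i]
      by (simp add: left_diff_distrib sum_subtractf del: add_2_eq_Suc')
  qed
qed

subsection \<open>The matrices\<close>

lemma reversal_mat_carrier [simp]: "reversal_mat q \<in> carrier_mat q q"
  and G_mat_carrier [simp]: "G_mat q \<in> carrier_mat q q"
  by (simp_all add: reversal_mat_def G_mat_def)

lemma dim_reversal_mat [simp]: "dim_row (reversal_mat q) = q" "dim_col (reversal_mat q) = q"
  and dim_G_mat [simp]: "dim_row (G_mat q) = q" "dim_col (G_mat q) = q"
  by (simp_all add: reversal_mat_def G_mat_def)

lemma index_mult_reversal:
  assumes A: "A \<in> carrier_mat q q" and ij: "i < q" "j < q"
  shows "(A * reversal_mat q) $$ (i, j) = A $$ (i, q - 1 - j)"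
    and "(reversal_mat q * A) $$ (i, j) = A $$ (q - 1 - i, j)"
proof -
  have "(A * reversal_mat q) $$ (i, j) = (\<Sum>k = 0..<q. A $$ (i, k) * (if k + j = q - 1 then 1 else 0))"
    using A ij by (auto simp: scalar_prod_def reversal_mat_def intro!: sum.cong)
  also have "\<dots> = (\<Sum>k = 0..<q. if k = q - 1 - j then A $$ (i, k) else 0)"
    by (intro sum.cong refl) (use ij in auto)
  finally show "(A * reversal_mat q) $$ (i, j) = A $$ (i, q - 1 - j)" using ij by simp
  have "(reversal_mat q * A) $$ (i, j) = (\<Sum>k = 0..<q. (if i + k = q - 1 then 1 else 0) * A $$ (k, j))"
    using A ij by (auto simp: scalar_prod_def reversal_mat_def intro!: sum.cong)
  also have "\<dots> = (\<Sum>k = 0..<q. if k = q - 1 - i then A $$ (k, j) else 0)"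
    by (intro sum.cong refl) (use ij in auto)
  finally show "(reversal_mat q * A) $$ (i, j) = A $$ (q - 1 - i, j)" using ij by simp
qed

lemma Omega_mat_carrier [simp]: "Omega_mat q \<in> carrier_mat q q"
  by (rule carrier_matI) (simp_all add: Omega_mat_def)

text \<open>As \<open>q\<close> is even, reversing an index changes the parity of the sign exponent;
  hence the minus sign in \<open>GR_entry\<close>.\<close>

lemma index_Omega_mat:
  assumes "even q" "i < q" "j < q"
  shows "Omega_mat q $$ (i, j) = GR_entry q i j - GR_entry q j i"
proof -
  have sgn: "(-1) ^ (a + (q - 1 - c)) = (- ((-1) ^ (a + c)) :: rat)" if "c < q" for a c
  proof -
    have "even (a + (q - 1 - c)) \<longleftrightarrow> odd (a + c)" using assms(1) that by auto
    thus ?thesis by (cases "even (a + c)") simp_all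
  qed
  have "(G_mat q * reversal_mat q) $$ (i, j) = GR_entry q i j"
    unfolding index_mult_reversal(1)[OF G_mat_carrier assms(2,3)]
    using assms sgn[of j i] by (simp add: G_mat_def GR_entry_def add.commute)
  moreover have "(reversal_mat q * G_mat q) $$ (i, j) = GR_entry q j i"
  proof -
    have "((q - 1 - i + j) choose (q - 1 - i)) = ((q - 1 - i + j) choose j)"
      using binomial_symmetric[of "q - 1 - i" "q - 1 - i + j"] by simp
    thus ?thesis
      unfolding index_mult_reversal(2)[OF G_mat_carrier assms(2,3)]
      using assms sgn[of i j] by (simp add: G_mat_def GR_entry_def add.commute)
  qed
  ultimately show ?thesis using assms by (simp add: Omega_mat_def)
qed

text \<open>Up to sign this is a \<open>k\<close>-th finite difference of a binomial coefficient in
  its upper argument, which lowers the lower argument by \<open>k\<close>.\<close>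

lemma alternating_binomial_sum:
  "(\<Sum>j\<le>k. (-1) ^ j * of_nat (k choose j) * of_nat ((m + j) choose i))
     = (if k \<le> i then (-1) ^ k * of_nat (m choose (i - k)) else (0 :: 'a::comm_ring_1))"
proof (induction k arbitrary: m i)
  case (Suc k)
  define f :: "nat \<Rightarrow> nat \<Rightarrow> nat \<Rightarrow> 'a" where "f m i j = (-1) ^ j * of_nat (k choose j) * of_nat ((m + j) choose i)" for m i j
  have "(\<Sum>j\<le>Suc k. (-1) ^ j * of_nat (Suc k choose j) * of_nat ((m + j) choose i)) =
     (\<Sum>j\<le>Suc k. f m i j) - (\<Sum>j\<le>k. f (Suc m) i j)"
  proof -
    have "(-1) ^ Suc j * of_nat (Suc k choose Suc j) * of_nat ((m + Suc j) choose i) =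
        f m i (Suc j) - f (Suc m) i j" for j
      by (simp add: f_def algebra_simps)
    hence "(\<Sum>j\<le>Suc k. (-1) ^ j * of_nat (Suc k choose j) * of_nat ((m + j) choose i)) =
        f m i 0 + (\<Sum>j\<le>k. f m i (Suc j) - f (Suc m) i j)"
      unfolding sum.atMost_Suc_shift by (simp add: f_def)
    thus ?thesis unfolding sum.atMost_Suc_shift by (simp add: sum_subtractf)
  qed
  also have "(\<Sum>j\<le>Suc k. f m i j) = (\<Sum>j\<le>k. f m i j)" by (simp add: f_def binomial_eq_0)
  also have "(\<Sum>j\<le>k. f m i j) - (\<Sum>j\<le>k. f (Suc m) i j) =
     (if Suc k \<le> i then (-1) ^ Suc k * of_nat (m choose (i - Suc k)) else 0)"
  proof (cases i)
    case 0
    thus ?thesis by (simp add: f_def)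
  next
    case (Suc l)
    have "(\<Sum>j\<le>k. f m i j) - (\<Sum>j\<le>k. f (Suc m) i j) = - (\<Sum>j\<le>k. f m l j)"
      by (simp add: Suc f_def algebra_simps flip: sum_subtractf sum_negf)
    thus ?thesis using Suc.IH[of m l] by (simp add: Suc f_def)
  qed
  finally show ?case .
qed simp

lemma sum_lessThan_eq_atMost:
  assumes "\<And>j. k < j \<Longrightarrow> f j = 0" "k < (q::nat)"
  shows "sum f {..<q} = sum f {..k}"
  by (rule sum.mono_neutral_right) (use assms in \<open>auto simp: not_le\<close>)

lemma alternating_binomial_sum_lessThan:
  assumes "k < q"
  shows "(\<Sum>j<q. (-1) ^ j * of_nat (k choose j) * of_nat ((m + j) choose i))
     = (if k \<le> i then (-1) ^ k * of_nat (m choose (i - k)) else (0 :: 'a::comm_ring_1))"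
proof -
  have "(\<Sum>j<q. (-1) ^ j * of_nat (k choose j) * of_nat ((m + j) choose i))
     = (\<Sum>j\<le>k. (-1) ^ j * of_nat (k choose j) * of_nat ((m + j) choose i) :: 'a)"
    by (rule sum_lessThan_eq_atMost) (simp_all add: binomial_eq_0 assms)
  thus ?thesis unfolding alternating_binomial_sum .
qed

text \<open>With the Pascal matrix \<open>P_ki = (k choose i)\<close> this is an entry of
  \<open>P^T P\<close>. Inverting \<open>P\<close> only inserts alternating signs, and
  \<open>G\<close> is \<open>P P^T\<close> with such signs.\<close>

definition G_inv_entry :: "nat \<Rightarrow> nat \<Rightarrow> nat \<Rightarrow> 'a::comm_semiring_1" where
  "G_inv_entry q i j = (\<Sum>k<q. of_nat (k choose i) * of_nat (k choose j))"

lemma G_inv_eq: "G_inv q = mat q q (\<lambda>(i, j). G_inv_entry q i j)"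
proof -
  define B :: "rat mat" where "B = mat q q (\<lambda>(i, j). G_inv_entry q i j)"
  have B: "B \<in> carrier_mat q q" by (simp add: B_def)
  have GB: "G_mat q * B = 1\<^sub>m q"
  proof (rule eq_matI)
    fix i l assume "i < dim_row (1\<^sub>m q :: rat mat)" "l < dim_col (1\<^sub>m q :: rat mat)"
    hence il: "i < q" "l < q" by auto
    have "(G_mat q * B) $$ (i, l) = (\<Sum>j<q. (-1) ^ (i + j) * of_nat ((i + j) choose i) * (\<Sum>k<q. of_nat (k choose j) * of_nat (k choose l)))"
      using il by (simp add: G_mat_def B_def scalar_prod_def G_inv_entry_def atLeast0LessThan)
    also have "\<dots> = (\<Sum>k<q. (-1) ^ i * of_nat (k choose l) * (\<Sum>j<q. (-1) ^ j * of_nat (k choose j) * of_nat ((i + j) choose i)))"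
      unfolding sum_distrib_left by (subst sum.swap) (intro sum.cong refl, simp add: power_add mult_ac)
    \<comment> \<open>The inner sum is a finite difference of order \<open>k\<close> and leaves
      \<open>(i choose k)\<close>. The outer sum is then one of order \<open>i\<close> at
      \<open>m = 0\<close>, which gives the Kronecker delta.\<close>
    also have "\<dots> = (\<Sum>k<q. (-1) ^ i * ((-1) ^ k * of_nat (i choose k) * of_nat ((0 + k) choose l)))"
    proof (intro sum.cong refl)
      fix k assume "k \<in> {..<q}"
      hence k: "k < q" by simp
      have "(if k \<le> i then (-1) ^ k * of_nat (i choose (i - k)) else 0) = ((-1) ^ k * of_nat (i choose k) :: rat)"
        by (simp add: binomial_symmetric[symmetric])
      thus "(-1) ^ i * of_nat (k choose l) * (\<Sum>j<q. (-1) ^ j * of_nat (k choose j) * of_nat ((i + j) choose i)) =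
        ((-1) ^ i * ((-1) ^ k * of_nat (i choose k) * of_nat ((0 + k) choose l)) :: rat)"
        unfolding alternating_binomial_sum_lessThan[OF k] by (simp add: mult_ac)
    qed
    also have "\<dots> = (-1) ^ i * (if i \<le> l then (-1) ^ i * of_nat (0 choose (l - i)) else 0)"
      unfolding sum_distrib_left[symmetric] alternating_binomial_sum_lessThan[OF il(1)] ..
    also have "\<dots> = (1\<^sub>m q :: rat mat) $$ (i, l)"
      using il by (cases "i = l") (auto simp: binomial_eq_0_iff simp flip: power_mult_distrib)
    finally show "(G_mat q * B) $$ (i, l) = 1\<^sub>m q $$ (i, l)" .
  qed (simp_all add: B_def G_mat_def)
  hence BG: "B * G_mat q = 1\<^sub>m q" by (rule mat_mult_left_right_inverse[OF G_mat_carrier B])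
  show ?thesis
  proof (cases "mat_inverse (G_mat q)")
    case None
    have "G_mat q \<in> Units (ring_mat TYPE(rat) q ())"
      using GB BG B by (auto simp: Units_def ring_mat_def)
    thus ?thesis using mat_inverse(1)[OF G_mat_carrier None, of "()"] by simp
  next
    case (Some C)
    from mat_inverse(2)[OF G_mat_carrier Some] have C: "C * G_mat q = 1\<^sub>m q" "C \<in> carrier_mat q q" by auto
    have "C = C * (G_mat q * B)" using C GB by simp
    also have "\<dots> = (C * G_mat q) * B" using C B by (intro assoc_mult_mat[symmetric]) auto
    also have "\<dots> = B" using C B by simp
    finally show ?thesis by (simp add: G_inv_def Some B_def)
  qed
qed

lemma J_mat_carrier [simp]: "J_mat q \<in> carrier_mat q q"
  by (rule carrier_matI) (simp_all add: J_mat_def G_inv_eq)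

lemma index_J_mat:
  assumes "i < q" "j < q"
  shows "J_mat q $$ (i, j) = G_inv_entry q (q - 1 - i) j - G_inv_entry q i (q - 1 - j)"
proof -
  have G: "G_inv q \<in> carrier_mat q q" by (simp add: G_inv_eq)
  show ?thesis
    using assms G index_mult_reversal[OF G assms]
    by (simp add: J_mat_def) (simp add: G_inv_eq)
qed

lemma G_inv_entry_sym: "G_inv_entry q i j = G_inv_entry q j i"
  by (simp add: G_inv_entry_def mult.commute)

lemma sum_binomial_power:
  assumes "k < q"
  shows "(\<Sum>i<q. of_nat (k choose i) * x ^ i) = (1 + x :: 'a::comm_ring_1) ^ k"
    and "(\<Sum>i<q. of_nat (k choose (q - 1 - i)) * x ^ i) = x ^ (q - Suc k) * (1 + x) ^ k"
proof -
  show *: "(\<Sum>i<q. of_nat (k choose i) * x ^ i) = (1 + x) ^ k" for x :: 'a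
  proof -
    have "(\<Sum>i<q. of_nat (k choose i) * x ^ i) = (\<Sum>i\<le>k. of_nat (k choose i) * x ^ i)"
      by (rule sum_lessThan_eq_atMost) (simp_all add: binomial_eq_0 assms)
    also have "\<dots> = (x + 1) ^ k" unfolding binomial_ring by simp
    finally show ?thesis by (simp add: add.commute)
  qed
  have "(\<Sum>i<q. of_nat (k choose (q - 1 - i)) * x ^ i) = (\<Sum>i<q. of_nat (k choose i) * x ^ (q - 1 - i))"
    by (rule sum.reindex_bij_witness[of _ "\<lambda>i. q - 1 - i" "\<lambda>i. q - 1 - i"]) auto
  also have "\<dots> = (\<Sum>i\<le>k. of_nat (k choose i) * x ^ (q - 1 - i))"
    by (rule sum_lessThan_eq_atMost) (simp_all add: binomial_eq_0 assms)
  also have "\<dots> = (\<Sum>i\<le>k. x ^ (q - Suc k) * (of_nat (k choose i) * 1 ^ i * x ^ (k - i)))"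
  proof (intro sum.cong refl)
    fix i assume "i \<in> {..k}"
    hence "q - 1 - i = (q - Suc k) + (k - i)" using assms by auto
    thus "of_nat (k choose i) * x ^ (q - 1 - i) = x ^ (q - Suc k) * (of_nat (k choose i) * 1 ^ i * x ^ (k - i))"
      by (simp add: power_add mult_ac)
  qed
  also have "\<dots> = x ^ (q - Suc k) * (1 + x) ^ k"
    unfolding binomial_ring sum_distrib_left ..
  finally show "(\<Sum>i<q. of_nat (k choose (q - 1 - i)) * x ^ i) = x ^ (q - Suc k) * (1 + x) ^ k" .
qed

text \<open>Summing the binomials leaves a geometric sum in \<open>x\<close> and
  \<open>(1 + x) (1 + y)\<close>, and the difference of these two is
  \<open>1 + y + x y\<close>.\<close>

lemma G_inv_entry_generating:
  fixes x y :: "'a::comm_ring_1"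
  shows "(1 + y + x * y) * (\<Sum>i<q. \<Sum>j<q. G_inv_entry q (q - 1 - i) j * x ^ i * y ^ j)
     = ((1 + x) * (1 + y)) ^ q - x ^ q"
proof -
  have "(\<Sum>i<q. \<Sum>j<q. G_inv_entry q (q - 1 - i) j * x ^ i * y ^ j) =
     (\<Sum>i<q. \<Sum>k<q. \<Sum>j<q. (of_nat (k choose (q - 1 - i)) * x ^ i) * (of_nat (k choose j) * y ^ j))"
    unfolding G_inv_entry_def sum_distrib_right by (subst sum.swap) (simp only: mult_ac)
  also have "\<dots> = (\<Sum>k<q. (\<Sum>i<q. of_nat (k choose (q - 1 - i)) * x ^ i) * (\<Sum>j<q. of_nat (k choose j) * y ^ j))"
    unfolding sum_product by (rule sum.swap)
  also have "\<dots> = (\<Sum>k<q. x ^ (q - Suc k) * ((1 + x) * (1 + y)) ^ k)"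
    by (intro sum.cong refl)
      (simp only: sum_binomial_power power_mult_distrib lessThan_iff, simp only: mult_ac)
  finally have *: "(\<Sum>i<q. \<Sum>j<q. G_inv_entry q (q - 1 - i) j * x ^ i * y ^ j) =
     (\<Sum>k<q. x ^ (q - Suc k) * ((1 + x) * (1 + y)) ^ k)" .
  have "1 + y + x * y = (1 + x) * (1 + y) - x" by (simp add: algebra_simps)
  thus ?thesis unfolding * power_diff_sumr2 by simp
qed

lemma G_inv_entry_generating':
  fixes x y :: "'a::comm_ring_1"
  shows "(1 + x + x * y) * (\<Sum>i<q. \<Sum>j<q. G_inv_entry q i (q - 1 - j) * x ^ i * y ^ j)
     = ((1 + x) * (1 + y)) ^ q - y ^ q"
proof -
  have "(\<Sum>i<q. \<Sum>j<q. G_inv_entry q i (q - 1 - j) * x ^ i * y ^ j) =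
     (\<Sum>i<q. \<Sum>j<q. G_inv_entry q (q - 1 - i) j * y ^ i * x ^ j)"
    by (subst sum.swap) (intro sum.cong refl, subst G_inv_entry_sym, simp add: mult_ac)
  thus ?thesis using G_inv_entry_generating[of x y q] by (simp add: mult_ac)
qed

subsection \<open>Rational functions in two variables\<close>

lemma to_fract_power: "to_fract (p ^ k) = to_fract p ^ k"
  by (induction k) simp_all

text \<open>Identifies the generic \<open>of_rat\<close> with the embedding of constants, by
  reducing to integers and clearing the denominator.\<close>

lemma of_rat_eq_to_fract: "of_rat r = (to_fract [:[:r:]:] :: ratfun2)"
proof -
  have nat: "to_fract (of_nat k) = (of_nat k :: ratfun2)" for k
    by (induction k) (simp_all only: of_nat_0 of_nat_Suc to_fract_0 to_fract_add to_fract_1)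
  have int: "to_fract [:[:of_int a:]:] = (of_int a :: ratfun2)" for a
  proof -
    have "to_fract (of_int a) = (of_int a :: ratfun2)"
      by (cases a rule: int_cases2) (simp_all only: of_int_minus of_int_of_nat_eq to_fract_uminus nat)
    thus ?thesis by (simp add: of_int_poly)
  qed
  obtain a c where r: "r = Rat.Fract a c" "c > 0" by (cases r) auto
  have rc: "r * of_int c = of_int a" using r by (simp add: Fract_of_int_quotient)
  have "to_fract [:[:r:]:] * of_int c = (to_fract ([:[:r:]:] * [:[:of_int c:]:]) :: ratfun2)"
    unfolding to_fract_mult int ..
  also have "[:[:r:]:] * [:[:of_int c:]:] = [:[:of_int a:]:]" by (simp add: rc)
  finally have "to_fract [:[:r:]:] * of_int c = (of_int a :: ratfun2)" unfolding int .
  moreover have "of_rat r * of_int c = (of_int a :: ratfun2)"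
    using arg_cong[OF rc, of "of_rat :: rat \<Rightarrow> ratfun2"] by (simp add: of_rat_mult)
  moreover have "(of_int c :: ratfun2) \<noteq> 0" using r(2) by simp
  ultimately show ?thesis by (metis mult_right_cancel)
qed

lemma indet_sum_eq_to_fract:
  "(\<Sum>i<m. \<Sum>j<n. of_rat (c i j) * indet_x ^ i * indet_y ^ j)
     = to_fract (\<Sum>i<m. \<Sum>j<n. monom (monom (c i j) i) j)"
proof -
  have "monom (monom (c i j) i) j = [:[:c i j:]:] * [:[:0, 1:]:] ^ i * [:0, 1:] ^ j" for i j
  proof -
    have "[:p:] ^ i = [:p ^ i:]" for p :: "rat poly" by (induction i) (simp_all add: one_pCons mult.commute)
    thus ?thesis by (simp add: monom_altdef)
  qed
  thus ?thesis
    by (simp only: to_fract_sum to_fract_mult to_fract_power of_rat_eq_to_fract indet_x_def indet_y_def)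
qed

text \<open>Algebraic independence of the indeterminates, for the invertibility of
  \<open>\<Omega>\<close> and for the uniqueness behind the \<open>THE\<close> in
  \<open>C_mat\<close>.\<close>

lemma indet_sum_eq_0_imp:
  assumes "(\<Sum>i<m. \<Sum>j<n. of_rat (c i j) * indet_x ^ i * indet_y ^ j) = 0" "i < m" "j < n"
  shows "c i j = 0"
proof -
  have "(\<Sum>i<m. \<Sum>j<n. monom (monom (c i j) i) j) = 0"
    using assms(1) unfolding indet_sum_eq_to_fract by (simp only: to_fract_eq_0_iff)
  hence "coeff (coeff (\<Sum>i<m. \<Sum>j<n. monom (monom (c i j) i) j) j) i = 0" by simp
  thus ?thesis using assms(2,3) by (simp add: coeff_sum if_distrib[of "\<lambda>p. coeff p i"] cong: if_cong)
qed

lemma indet_nonzero: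
  "indet_x \<noteq> 0" "indet_x \<noteq> -1" "indet_y \<noteq> 0" "1 + indet_y \<noteq> 0" "indet_y\<^sup>2 + indet_y + 1 \<noteq> 0"
  "indet_y - indet_x \<noteq> 0" "1 + indet_x + indet_x * indet_y \<noteq> 0" "1 + indet_y + indet_x * indet_y \<noteq> 0"
proof -
  have x: "1 + indet_x \<noteq> 0"
    unfolding indet_x_def to_fract_1[symmetric] to_fract_add[symmetric] to_fract_eq_0_iff
    by (simp add: one_pCons)
  thus "indet_x \<noteq> -1" by auto
  show "indet_x \<noteq> 0" "indet_y \<noteq> 0" by (simp_all add: indet_x_def indet_y_def)
  show "1 + indet_y \<noteq> 0" "indet_y\<^sup>2 + indet_y + 1 \<noteq> 0" "indet_y - indet_x \<noteq> 0"
    "1 + indet_x + indet_x * indet_y \<noteq> 0" "1 + indet_y + indet_x * indet_y \<noteq> 0"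
    unfolding indet_x_def indet_y_def to_fract_1[symmetric] to_fract_power[symmetric] to_fract_mult[symmetric]
      to_fract_add[symmetric] to_fract_diff[symmetric] to_fract_eq_0_iff
    by (simp_all add: one_pCons power2_eq_square)
qed

lemma GR_entry_of_rat: "of_rat (GR_entry q i j) = GR_entry q i j"
  by (simp add: GR_entry_def of_rat_mult of_rat_power of_rat_minus)

lemma G_inv_entry_of_rat: "of_rat (G_inv_entry q i j) = G_inv_entry q i j"
  by (simp add: G_inv_entry_def of_rat_mult of_rat_sum)

section \<open>Invertibility of Omega and identification of its inverse\<close>

theorem theorem7p2:
  fixes N :: nat
  assumes "N \<ge> 1"
  shows "Omega_mat (2 * N) * (J_mat (2 * N) - C_mat N) = 1\<^sub>m (2 * N)
    \<and> mat_inverse (Omega_mat (2 * N)) = Some (J_mat (2 * N) - C_mat N)"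
proof -
  define q where "q = 2 * N"
  obtain n where n: "N = Suc n" using assms by (cases N) auto
  have q: "q = 2 * n + 2" "even q" by (simp_all add: q_def n)
  define x y where "x = indet_x" and "y = indet_y"
  note nz = indet_nonzero[folded x_def y_def]
  obtain k :: "ratfun2 poly" where k: "degree k < q"
    and kx: "(h_coeff (Suc n) 0)\<^sup>2 * ((y - x) * (1 + x + x * y) * (1 + y + x * y)) * poly k x = - kernel_num n x y"
    and Om: "\<forall>i<q. (\<Sum>j<q. (GR_entry q i j - GR_entry q j i) * coeff k j) = y ^ i"
    using kernel_solution[OF nz(3-5), of n] nz(1,2) unfolding q(1) by blast
  define \<Omega> where "\<Omega> = Omega_mat q"
  have \<Omega>: "\<Omega> \<in> carrier_mat q q" by (simp add: \<Omega>_def)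
  have Ok: "(\<Sum>j<q. of_rat (\<Omega> $$ (i, j)) * coeff k j) = y ^ i" if "i < q" for i
  proof -
    have "(\<Sum>j<q. of_rat (\<Omega> $$ (i, j)) * coeff k j) = (\<Sum>j<q. (GR_entry q i j - GR_entry q j i) * coeff k j)"
      by (intro sum.cong refl) (use q that in \<open>simp add: \<Omega>_def index_Omega_mat of_rat_diff GR_entry_of_rat\<close>)
    thus ?thesis using Om that by simp
  qed
  \<comment> \<open>Otherwise a nonzero rational row vector \<open>w\<close> annihilates
    \<open>\<Omega>\<close>, and pairing it with \<open>Ok\<close> gives a rational linear relation
    among powers of \<open>y\<close>.\<close>
  have "det \<Omega> \<noteq> 0"
  proof
    assume "det \<Omega> = 0"
    hence "det (transpose_mat \<Omega>) = 0" using det_transpose[OF \<Omega>] by simp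
    then obtain w where w: "w \<in> carrier_vec q" "w \<noteq> 0\<^sub>v q" "transpose_mat \<Omega> *\<^sub>v w = 0\<^sub>v q"
      using det_0_iff_vec_prod_zero_field[of "transpose_mat \<Omega>" q] \<Omega> by auto
    have wO: "(\<Sum>i<q. w $ i * \<Omega> $$ (i, j)) = 0" if "j < q" for j
    proof -
      have "(transpose_mat \<Omega> *\<^sub>v w) $ j = 0" using w(3) that by simp
      moreover have "(transpose_mat \<Omega> *\<^sub>v w) $ j = (\<Sum>i<q. w $ i * \<Omega> $$ (i, j))"
        using w(1) \<Omega> that by (simp add: scalar_prod_def atLeast0LessThan mult.commute)
      ultimately show ?thesis by simp
    qed
    \<comment> \<open>The dummy sum over \<open>i < 1\<close> puts the relation into the form of
      \<open>indet_sum_eq_0_imp\<close>.\<close>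
    have "(\<Sum>i<1. \<Sum>j<q. of_rat (w $ j) * indet_x ^ i * indet_y ^ j) = (\<Sum>i<q. of_rat (w $ i) * y ^ i)"
      by (simp add: y_def)
    also have "\<dots> = (\<Sum>i<q. \<Sum>j<q. of_rat (w $ i) * (of_rat (\<Omega> $$ (i, j)) * coeff k j))"
      by (intro sum.cong refl) (simp add: Ok flip: sum_distrib_left)
    also have "\<dots> = (\<Sum>j<q. of_rat (\<Sum>i<q. w $ i * \<Omega> $$ (i, j)) * coeff k j)"
      unfolding of_rat_sum of_rat_mult sum_distrib_right by (subst sum.swap) (simp only: mult.assoc)
    also have "\<dots> = 0" by (simp add: wO)
    finally have "w $ j = 0" if "j < q" for j
      by (rule indet_sum_eq_0_imp[where i = 0]) (use that in simp_all)
    hence "w = 0\<^sub>v q" using w(1) by (intro eq_vecI) auto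
    thus False using w(2) by simp
  qed
  hence "\<Omega> \<in> Units (ring_mat TYPE(rat) q ())" by (rule det_non_zero_imp_unit[OF \<Omega>])
  then obtain M where M: "mat_inverse \<Omega> = Some M"
    using mat_inverse(1)[OF \<Omega>, of "()"] by (cases "mat_inverse \<Omega>") auto
  from mat_inverse(2)[OF \<Omega> M] have inv: "\<Omega> * M = 1\<^sub>m q" "M * \<Omega> = 1\<^sub>m q" and Mc: "M \<in> carrier_mat q q" by auto
  \<comment> \<open>Multiplying \<open>Ok\<close> by \<open>M\<close> from the left solves for the
    coefficients of \<open>k\<close>, so that \<open>poly k x\<close> becomes the generating
    function of \<open>M\<close>.\<close>
  have coeff_k: "coeff k i = (\<Sum>j<q. of_rat (M $$ (i, j)) * y ^ j)" if i: "i < q" for i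
  proof -
    have MO: "(\<Sum>j<q. M $$ (i, j) * \<Omega> $$ (j, l)) = (if i = l then 1 else 0)" if "l < q" for l
    proof -
      have "(M * \<Omega>) $$ (i, l) = (\<Sum>j<q. M $$ (i, j) * \<Omega> $$ (j, l))"
        using Mc \<Omega> i that by (simp add: scalar_prod_def atLeast0LessThan)
      thus ?thesis using inv(2) i that by simp
    qed
    have "(\<Sum>j<q. of_rat (M $$ (i, j)) * y ^ j) = (\<Sum>j<q. \<Sum>l<q. of_rat (M $$ (i, j)) * (of_rat (\<Omega> $$ (j, l)) * coeff k l))"
      by (intro sum.cong refl) (simp add: Ok flip: sum_distrib_left)
    also have "\<dots> = (\<Sum>l<q. of_rat (\<Sum>j<q. M $$ (i, j) * \<Omega> $$ (j, l)) * coeff k l)"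
      unfolding of_rat_sum of_rat_mult sum_distrib_right by (subst sum.swap) (simp only: mult.assoc)
    also have "\<dots> = (\<Sum>l<q. if i = l then coeff k l else 0)"
      by (intro sum.cong refl) (simp add: MO)
    also have "\<dots> = coeff k i" using i by simp
    finally show ?thesis ..
  qed
  have poly_k: "poly k x = (\<Sum>i<q. \<Sum>j<q. of_rat (M $$ (i, j)) * x ^ i * y ^ j)"
  proof -
    have "k = (\<Sum>i<q. monom (coeff k i) i)"
      by (rule poly_eqI) (use k in \<open>auto simp: coeff_sum intro: coeff_eq_0\<close>)
    from arg_cong[OF this, of "\<lambda>p. poly p x"]
    have "poly k x = (\<Sum>i<q. coeff k i * x ^ i)" unfolding poly_sum poly_monom .
    also have "\<dots> = (\<Sum>i<q. \<Sum>j<q. of_rat (M $$ (i, j)) * x ^ i * y ^ j)"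
      by (intro sum.cong refl) (simp add: coeff_k sum_distrib_left mult_ac)
    finally show ?thesis .
  qed
  define A where "A = ((1 + x) * (1 + y)) ^ q"
  define p r where "p = 1 + x + x * y" and "r = 1 + y + x * y"
  have pr: "p \<noteq> 0" "r \<noteq> 0" "y - x \<noteq> 0" using nz by (simp_all add: p_def r_def)
  have J: "(\<Sum>i<q. \<Sum>j<q. of_rat (J_mat q $$ (i, j)) * x ^ i * y ^ j) = (A - x ^ q) / r - (A - y ^ q) / p"
  proof -
    have "(\<Sum>i<q. \<Sum>j<q. of_rat (J_mat q $$ (i, j)) * x ^ i * y ^ j) =
       (\<Sum>i<q. \<Sum>j<q. G_inv_entry q (q - 1 - i) j * x ^ i * y ^ j - G_inv_entry q i (q - 1 - j) * x ^ i * y ^ j)"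
      by (intro sum.cong refl) (simp add: index_J_mat of_rat_diff G_inv_entry_of_rat left_diff_distrib)
    moreover have "(\<Sum>i<q. \<Sum>j<q. G_inv_entry q (q - 1 - i) j * x ^ i * y ^ j) = (A - x ^ q) / r"
      using G_inv_entry_generating[of y x q] pr(2) unfolding A_def r_def by (simp add: eq_divide_eq mult.commute)
    moreover have "(\<Sum>i<q. \<Sum>j<q. G_inv_entry q i (q - 1 - j) * x ^ i * y ^ j) = (A - y ^ q) / p"
      using G_inv_entry_generating'[of x y q] pr(1) unfolding A_def p_def by (simp add: eq_divide_eq mult.commute)
    ultimately show ?thesis by (simp add: sum_subtractf)
  qed
  have C: "C_fun N x y = (\<Sum>i<q. \<Sum>j<q. of_rat ((J_mat q - M) $$ (i, j)) * x ^ i * y ^ j)"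
  proof -
    define b where "b = (h_coeff (Suc n) 0 :: ratfun2)"
    have b: "b \<noteq> 0" by (simp add: b_def h_coeff_0_nonzero)
    define WW where "WW = W_fun N x y * W_star N x y"
    have kk: "b\<^sup>2 * ((y - x) * p * r) * poly k x = - (b\<^sup>2 * A * (y - x)\<^sup>2 + WW)"
      using kx unfolding kernel_num_def b_def[symmetric] p_def r_def A_def WW_def n q(1) .
    have "H_fun N x y = WW / (b\<^sup>2 * (y - x) * p * r)"
      unfolding H_fun_def WW_def p_def r_def n b_coeff_eq b_def ..
    also have "WW = - (b\<^sup>2 * ((y - x) * p * r) * poly k x) - b\<^sup>2 * A * (y - x)\<^sup>2"
      using kk by simp
    also have "\<dots> / (b\<^sup>2 * (y - x) * p * r) = - poly k x - A * (y - x) / (p * r)"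
      using b pr by (simp add: field_simps power2_eq_square)
    finally have H: "H_fun N x y = - poly k x - A * (y - x) / (p * r)" .
    have "C_fun N x y = - poly k x - A * (y - x) / (p * r) - x ^ q / r + y ^ q / p"
      unfolding C_fun_def H p_def r_def q_def ..
    \<comment> \<open>This splits the \<open>A\<close> term of the kernel into the two
      \<open>A\<close> terms in the generating function of \<open>J_mat q\<close>.\<close>
    also have "y - x = r - p" by (simp add: p_def r_def)
    also have "A * (r - p) / (p * r) = A / p - A / r" using pr by (simp add: field_simps)
    finally have "C_fun N x y = ((A - x ^ q) / r - (A - y ^ q) / p) - poly k x"
      by (simp add: diff_divide_distrib)
    also have "\<dots> = (\<Sum>i<q. \<Sum>j<q. of_rat ((J_mat q - M) $$ (i, j)) * x ^ i * y ^ j)"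
      unfolding J[symmetric] poly_k sum_subtractf[symmetric]
      by (intro sum.cong refl) (use Mc in \<open>simp add: of_rat_diff left_diff_distrib\<close>)
    finally show ?thesis .
  qed
  \<comment> \<open>The expansion \<open>C\<close> gives existence, and the independence of the
    indeterminates gives uniqueness.\<close>
  have "C_mat N = J_mat q - M"
    unfolding C_mat_def
  proof (rule the_equality)
    show "J_mat q - M \<in> carrier_mat (2 * N) (2 * N) \<and> C_fun N indet_x indet_y =
        (\<Sum>i<2 * N. \<Sum>j<2 * N. of_rat ((J_mat q - M) $$ (i, j)) * indet_x ^ i * indet_y ^ j)"
      using C Mc unfolding x_def y_def q_def by auto
    fix D assume D: "D \<in> carrier_mat (2 * N) (2 * N) \<and> C_fun N indet_x indet_y =
        (\<Sum>i<2 * N. \<Sum>j<2 * N. of_rat (D $$ (i, j)) * indet_x ^ i * indet_y ^ j)"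
    have "(\<Sum>i<q. \<Sum>j<q. of_rat (D $$ (i, j) - (J_mat q - M) $$ (i, j)) * indet_x ^ i * indet_y ^ j) = 0"
      using D C unfolding x_def y_def q_def by (simp add: of_rat_diff left_diff_distrib sum_subtractf)
    hence "D $$ (i, j) = (J_mat q - M) $$ (i, j)" if "i < q" "j < q" for i j
      using indet_sum_eq_0_imp[OF _ that] by fastforce
    thus "D = J_mat q - M" using D Mc by (intro eq_matI) (auto simp: q_def)
  qed
  moreover have "J_mat q - (J_mat q - M) = M"
    by (rule eq_matI) (use Mc carrier_matD[OF J_mat_carrier[of q]] in auto)
  ultimately have JC: "J_mat (2 * N) - C_mat N = M" by (simp add: q_def)
  show ?thesis unfolding JC using inv(1) M by (simp add: \<Omega>_def q_def)
qed

end
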